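(* Let $G$ be a compact Abelian group, $f\in C(G)$ with $f\ne0$, $X,Y$ Banach spaces, $T\in L(X,Y)$ with $T\neq0$, and $0<r,s<\infty$. If the operator $T_f: M(G,X)\to C(G,Y)$ can be factored through an $S_{r,s}$-operator, then the operators $\star f: M(G)\to C(G)$ and $T: X\to Y$ can both be factored through $S_{r,s}$-operators. The same is true for $r=s=\infty$.
   Context: All Banach spaces are complex. $M(G)=C(G)^*$ is the space of finite regular Borel complex measures on $G$; $M(G,X)$ is the Banach space of regular Borel $X$-valued measures of bounded variation; $C(G,Y)$ is the space of continuous $Y$-valued functions on $G$ with the sup norm. The convolution operator is $(\star f)(\mu)(g)=\int_G f(g-h)\,d\mu(h)$. The operator $T_f$ is $T_f(\overline\mu)(g)=\int_G f(g-t)\,d(T\overline\mu)(t)$, $\overline\mu\in M(G,X)$, where $(T\overline\mu)(E)=T(\overline\mu(E))$. For a Hilbert space $H$ and $0<r,s<\infty$, the Lorentz–Schatten class $S_{r,s}(H)$ consists of compact operators on $H$ whose singular numbers $(s_n)$ satisfy $\sum_n n^{s/r-1}s_n^s<\infty$. For $r=s=\infty$, $S_{\infty,\infty}(H)=S_\infty(H)$ is understood as the class $L(H)$ of all bounded operators (so the factorization is through a Hilbert space). An operator $S\in L(Z,W)$ can be factored through an $S_{r,s}$-operator if there are a Hilbert space $H$, $U\in S_{r,s}(H)$ and bounded $A: Z\to H$, $B: H\to W$ with $S=BUA$. *)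

theory Defs
  imports "HOL-Analysis.Analysis"
begin

section \<open>Complex normed and Banach spaces\<close>

class complex_normed_vector = real_normed_vector +
  fixes scaleC :: "complex \<Rightarrow> 'a \<Rightarrow> 'a"  (infixr \<open>*\<^sub>C\<close> 75)
  assumes scaleC_add_right: "c *\<^sub>C (x + y) = c *\<^sub>C x + c *\<^sub>C y"
    and scaleC_add_left: "(c + d) *\<^sub>C x = c *\<^sub>C x + d *\<^sub>C x"
    and scaleC_scaleC: "c *\<^sub>C d *\<^sub>C x = (c * d) *\<^sub>C x"
    and scaleR_scaleC: "a *\<^sub>R x = complex_of_real a *\<^sub>C x"
    and norm_scaleC: "norm (c *\<^sub>C x) = cmod c * norm x"

class complex_banach = complex_normed_vector + banach

instantiation complex :: complex_banach
begin

definition scaleC_complex :: "complex \<Rightarrow> complex \<Rightarrow> complex"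
  where "scaleC_complex c z = c * z"

instance
  by standard (auto simp: scaleC_complex_def algebra_simps norm_mult scaleR_conv_of_real)

end

definition bounded_clinear ::
    "('x::complex_normed_vector \<Rightarrow> 'y::complex_normed_vector) \<Rightarrow> bool"
  where "bounded_clinear T \<longleftrightarrow> bounded_linear T \<and> (\<forall>c x. T (c *\<^sub>C x) = c *\<^sub>C T x)"

lemma bounded_linear_scaleC: "bounded_linear ((*\<^sub>C) c :: 'x \<Rightarrow> 'x::complex_normed_vector)"
proof (rule bounded_linear_intro[where K = "cmod c"])
  fix a :: real and x y :: 'x
  show "c *\<^sub>C (x + y) = c *\<^sub>C x + c *\<^sub>C y"
    by (rule scaleC_add_right)
  show "c *\<^sub>C (a *\<^sub>R x) = a *\<^sub>R (c *\<^sub>C x)"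
    by (simp add: scaleR_scaleC scaleC_scaleC mult.commute)
  show "norm (c *\<^sub>C x) \<le> norm x * cmod c"
    by (simp add: norm_scaleC mult.commute)
qed


section \<open>The space \<open>C(G, Y)\<close>\<close>

text \<open>
  For compact \<open>G\<close> the library type \<open>'g \<Rightarrow>\<^sub>C 'y\<close> of bounded continuous functions is the
  space of all continuous functions with the sup norm.
\<close>

instantiation bcontfun :: (topological_space, complex_normed_vector) complex_normed_vector
begin

definition scaleC_bcontfun :: "complex \<Rightarrow> ('a \<Rightarrow>\<^sub>C 'b) \<Rightarrow> 'a \<Rightarrow>\<^sub>C 'b"
  where "scaleC_bcontfun c f = Bcontfun (\<lambda>x. c *\<^sub>C f x)"

lemma apply_bcontfun_scaleC [simp]:
  fixes f :: "'a \<Rightarrow>\<^sub>C 'b"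
  shows "apply_bcontfun (c *\<^sub>C f) x = c *\<^sub>C f x"
proof -
  have "(\<lambda>x. c *\<^sub>C f x) \<in> bcontfun"
    unfolding bcontfun_def
    using bounded_linear_image[OF bounded_apply_bcontfun[of f] bounded_linear_scaleC[of c]]
    by (auto intro!: bounded_linear.continuous_on[OF bounded_linear_scaleC]
        simp: image_image)
  then show ?thesis
    by (simp add: scaleC_bcontfun_def Bcontfun_inverse)
qed

instance
proof
  fix c d :: complex and a :: real and f g :: "'a \<Rightarrow>\<^sub>C 'b"
  show "c *\<^sub>C (f + g) = c *\<^sub>C f + c *\<^sub>C g"
    by (rule bcontfun_eqI) (simp add: scaleC_add_right)
  show "(c + d) *\<^sub>C f = c *\<^sub>C f + d *\<^sub>C f"
    by (rule bcontfun_eqI) (simp add: scaleC_add_left)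
  show "c *\<^sub>C d *\<^sub>C f = (c * d) *\<^sub>C f"
    by (rule bcontfun_eqI) (simp add: scaleC_scaleC)
  show "a *\<^sub>R f = complex_of_real a *\<^sub>C f"
    by (rule bcontfun_eqI) (simp add: scaleR_scaleC)
  have le: "norm (c *\<^sub>C f) \<le> cmod c * norm f" for c and f :: "'a \<Rightarrow>\<^sub>C 'b"
    by (rule norm_bound) (simp add: norm_scaleC norm_bounded mult_left_mono)
  show "norm (c *\<^sub>C f) = cmod c * norm f"
  proof (cases "c = 0")
    case True
    then show ?thesis using le[of c f] by simp
  next
    case False
    have one: "1 *\<^sub>C f = f"
      by (rule bcontfun_eqI) (simp flip: scaleR_scaleC[of 1, simplified])
    have "norm f = norm (inverse c *\<^sub>C (c *\<^sub>C f))"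
    proof -
      have "inverse c *\<^sub>C (c *\<^sub>C f) = 1 *\<^sub>C f"
        using False by (intro bcontfun_eqI) (simp add: scaleC_scaleC)
      then show ?thesis using one by simp
    qed
    also have "\<dots> \<le> cmod (inverse c) * norm (c *\<^sub>C f)"
      by (rule le)
    finally have "cmod c * norm f \<le> cmod c * (cmod (inverse c) * norm (c *\<^sub>C f))"
      by (rule mult_left_mono) simp
    also have "\<dots> = norm (c *\<^sub>C f)"
      using False by (simp add: norm_inverse)
    finally have "cmod c * norm f \<le> norm (c *\<^sub>C f)" .
    with le[of c f] show ?thesis by simp
  qed
qed

end


section \<open>The space \<open>M(G, X)\<close>\<close>

definition disj_families :: "'g::topological_space set \<Rightarrow> 'g set set set"
  where "disj_families E = {P. finite P \<and> disjoint P \<and> P \<subseteq> sets borel \<and> \<Union>P \<subseteq> E}"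

definition variation ::
    "('g::topological_space set \<Rightarrow> 'x::real_normed_vector) \<Rightarrow> 'g set \<Rightarrow> ennreal"
  where "variation m E = (SUP P\<in>disj_families E. \<Sum>A\<in>P. ennreal (norm (m A)))"

text \<open>
  Countably additive \<open>X\<close>-valued Borel measures of bounded variation whose variation is regular.
  A measure is a function on all subsets, set to \<open>0\<close> outside the Borel sets so that equality
  of functions is equality of measures.
\<close>

definition regular_bv_measures ::
    "('g::topological_space set \<Rightarrow> 'x::real_normed_vector) set"
  where "regular_bv_measures = {m.
    (\<forall>E. E \<notin> sets borel \<longrightarrow> m E = 0) \<and>
    (\<forall>A :: nat \<Rightarrow> 'g set. range A \<subseteq> sets borel \<longrightarrow> disjoint_family A \<longrightarrow>
      (\<lambda>n. m (A n)) sums m (\<Union>n. A n)) \<and>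
    variation m UNIV < \<infinity> \<and>
    (\<forall>E\<in>sets borel. \<forall>\<epsilon>>0. \<exists>K V. compact K \<and> open V \<and> K \<subseteq> E \<and> E \<subseteq> V \<and>
      variation m (V - K) < ennreal \<epsilon>)}"

lemma variation_mono: "E \<subseteq> F \<Longrightarrow> variation m E \<le> variation m F"
  unfolding variation_def disj_families_def by (rule SUP_subset_mono) auto

lemma variation_add:
  "variation (\<lambda>E. m E + m' E) F \<le> variation m F + variation m' F"
  unfolding variation_def
proof (rule SUP_least)
  fix P :: "'a set set" assume P: "P \<in> disj_families F"
  have "(\<Sum>A\<in>P. ennreal (norm (m A + m' A)))
      \<le> (\<Sum>A\<in>P. ennreal (norm (m A)) + ennreal (norm (m' A)))"
    by (intro sum_mono) (simp add: norm_triangle_ineq flip: ennreal_plus)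
  also have "\<dots> = (\<Sum>A\<in>P. ennreal (norm (m A))) + (\<Sum>A\<in>P. ennreal (norm (m' A)))"
    by (rule sum.distrib)
  also have "\<dots> \<le> (SUP P\<in>disj_families F. \<Sum>A\<in>P. ennreal (norm (m A)))
      + (SUP P\<in>disj_families F. \<Sum>A\<in>P. ennreal (norm (m' A)))"
    by (intro add_mono SUP_upper P)
  finally show "(\<Sum>A\<in>P. ennreal (norm (m A + m' A))) \<le> \<dots>" .
qed

lemma variation_scale:
  assumes "\<And>x. norm (T x) = k * norm x" "k \<ge> 0"
  shows "variation (\<lambda>E. T (m E)) F = ennreal k * variation m F"
proof -
  have "(\<Sum>A\<in>P. ennreal (norm (T (m A)))) = ennreal k * (\<Sum>A\<in>P. ennreal (norm (m A)))" for P
    unfolding sum_distrib_left using assms by (intro sum.cong refl) (simp add: ennreal_mult)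
  then show ?thesis
    unfolding variation_def SUP_mult_left_ennreal by presburger
qed

lemma variation_image:
  assumes "\<And>x. norm (T x) \<le> k * norm x" "k \<ge> 0"
  shows "variation (\<lambda>E. T (m E)) F \<le> ennreal k * variation m F"
  unfolding variation_def SUP_mult_left_ennreal sum_distrib_left
  by (intro SUP_mono' sum_mono) (simp add: assms ennreal_leI flip: ennreal_mult)

lemma norm_le_variation:
  assumes "E \<in> sets borel"
  shows "ennreal (norm (m E)) \<le> variation m E"
proof -
  have "{E} \<in> disj_families E"
    using assms by (simp add: disj_families_def)
  then have "(\<Sum>A\<in>{E}. ennreal (norm (m A))) \<le> variation m E"
    unfolding variation_def by (rule SUP_upper)
  then show ?thesis by simp
qed

lemma variation_zero [simp]: "variation (\<lambda>_. 0) E = 0"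
proof -
  have "{} \<in> disj_families E"
    by (simp add: disj_families_def)
  then have "disj_families E \<noteq> {}"
    by blast
  then show ?thesis
    by (simp add: variation_def)
qed

lemma zero_regular_bv: "(\<lambda>_. 0) \<in> regular_bv_measures"
proof -
  have "\<exists>K V. compact K \<and> open V \<and> K \<subseteq> E \<and> E \<subseteq> V" for E :: "'a set"
    by (intro exI[of _ "{}"] exI[of _ UNIV]) auto
  then show ?thesis
    by (simp add: regular_bv_measures_def)
qed

lemma add_regular_bv:
  assumes "m \<in> regular_bv_measures" "m' \<in> regular_bv_measures"
  shows "(\<lambda>E. m E + m' E) \<in> regular_bv_measures"
  unfolding regular_bv_measures_def
proof (intro CollectI conjI allI impI ballI)
  fix E :: "'a set" assume "E \<notin> sets borel"
  then show "m E + m' E = 0"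
    using assms by (auto simp: regular_bv_measures_def)
next
  fix A :: "nat \<Rightarrow> 'a set" assume "range A \<subseteq> sets borel" "disjoint_family A"
  then show "(\<lambda>n. m (A n) + m' (A n)) sums (m (\<Union>n. A n) + m' (\<Union>n. A n))"
    using assms by (intro sums_add) (auto simp: regular_bv_measures_def)
next
  have "variation m UNIV < \<infinity>" "variation m' UNIV < \<infinity>"
    using assms by (auto simp: regular_bv_measures_def)
  then show "variation (\<lambda>E. m E + m' E) UNIV < \<infinity>"
    by (intro le_less_trans[OF variation_add]) simp
next
  fix E :: "'a set" and \<epsilon> :: real assume E: "E \<in> sets borel" and "\<epsilon> > 0"
  then have "\<epsilon> / 2 > 0" by simp
  obtain K V where 1: "compact K" "open V" "K \<subseteq> E" "E \<subseteq> V"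
      "variation m (V - K) < ennreal (\<epsilon> / 2)"
    using assms(1) E \<open>\<epsilon> / 2 > 0\<close> unfolding regular_bv_measures_def by blast
  obtain K' V' where 2: "compact K'" "open V'" "K' \<subseteq> E" "E \<subseteq> V'"
      "variation m' (V' - K') < ennreal (\<epsilon> / 2)"
    using assms(2) E \<open>\<epsilon> / 2 > 0\<close> unfolding regular_bv_measures_def by blast
  have "variation (\<lambda>E. m E + m' E) (V \<inter> V' - (K \<union> K'))
      \<le> variation m (V \<inter> V' - (K \<union> K')) + variation m' (V \<inter> V' - (K \<union> K'))"
    by (rule variation_add)
  also have "\<dots> \<le> variation m (V - K) + variation m' (V' - K')"
    by (intro add_mono variation_mono) auto
  also have "\<dots> < ennreal (\<epsilon> / 2) + ennreal (\<epsilon> / 2)"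
    using 1(5) 2(5) by (rule add_strict_mono)
  also have "\<dots> = ennreal \<epsilon>"
    using \<open>\<epsilon> > 0\<close> by (simp flip: ennreal_plus)
  finally show "\<exists>K V. compact K \<and> open V \<and> K \<subseteq> E \<and> E \<subseteq> V \<and>
      variation (\<lambda>E. m E + m' E) (V - K) < ennreal \<epsilon>"
    using 1 2 by (intro exI[of _ "K \<union> K'"] exI[of _ "V \<inter> V'"]) (auto simp: compact_Un)
qed

lemma image_regular_bv:
  fixes m :: "'g::topological_space set \<Rightarrow> 'x::real_normed_vector"
    and T :: "'x \<Rightarrow> 'y::real_normed_vector"
  assumes T: "bounded_linear T" and m: "m \<in> regular_bv_measures"
  shows "(\<lambda>E. T (m E)) \<in> regular_bv_measures"
proof -
  obtain k where k: "k > 0" "\<And>x. norm (T x) \<le> k * norm x"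
    using bounded_linear.pos_bounded[OF T] by (metis mult.commute)
  have var: "variation (\<lambda>E. T (m E)) F \<le> ennreal k * variation m F" for F
    using k by (intro variation_image) auto
  show ?thesis
    unfolding regular_bv_measures_def
  proof (intro CollectI conjI allI impI ballI)
    fix E :: "'g set" assume "E \<notin> sets borel"
    then show "T (m E) = 0"
      using m T by (auto simp: regular_bv_measures_def linear_simps)
  next
    fix A :: "nat \<Rightarrow> 'g set" assume "range A \<subseteq> sets borel" "disjoint_family A"
    then show "(\<lambda>n. T (m (A n))) sums T (m (\<Union>n. A n))"
      using m by (intro bounded_linear.sums[OF T]) (auto simp: regular_bv_measures_def)
  next
    have "variation m UNIV < \<infinity>"
      using m by (auto simp: regular_bv_measures_def)
    then show "variation (\<lambda>E. T (m E)) UNIV < \<infinity>"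
      using var[of UNIV] by (auto simp: ennreal_mult_less_top intro: le_less_trans)
  next
    fix E :: "'g set" and \<epsilon> :: real assume E: "E \<in> sets borel" and "\<epsilon> > 0"
    then have "\<epsilon> / k > 0" using k by simp
    obtain K V where *: "compact K" "open V" "K \<subseteq> E" "E \<subseteq> V"
        "variation m (V - K) < ennreal (\<epsilon> / k)"
      using m E \<open>\<epsilon> / k > 0\<close> unfolding regular_bv_measures_def by blast
    have "variation (\<lambda>E. T (m E)) (V - K) \<le> ennreal k * variation m (V - K)"
      by (rule var)
    also have "\<dots> < ennreal k * ennreal (\<epsilon> / k)"
      using k * by (intro ennreal_mult_strict_left_mono) auto
    also have "\<dots> = ennreal \<epsilon>"
      using k \<open>\<epsilon> > 0\<close> by (simp flip: ennreal_mult)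
    finally show "\<exists>K V. compact K \<and> open V \<and> K \<subseteq> E \<and> E \<subseteq> V \<and>
        variation (\<lambda>E. T (m E)) (V - K) < ennreal \<epsilon>"
      using * by blast
  qed
qed

typedef (overloaded) ('g, 'x) vmeasure =
    "regular_bv_measures :: ('g::topological_space set \<Rightarrow> 'x::real_normed_vector) set"
  morphisms measure_of_set Abs_vmeasure
  using zero_regular_bv by blast

lemma vmeasure_eqI:
  "(\<And>E. measure_of_set \<mu> E = measure_of_set \<nu> E) \<Longrightarrow> \<mu> = \<nu>"
  by (metis ext measure_of_set_inject)

instantiation vmeasure :: (topological_space, real_normed_vector) real_vector
begin

definition zero_vmeasure :: "('a, 'b) vmeasure"
  where "0 = Abs_vmeasure (\<lambda>_. 0)"

definition plus_vmeasure :: "('a, 'b) vmeasure \<Rightarrow> ('a, 'b) vmeasure \<Rightarrow> ('a, 'b) vmeasure"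
  where "\<mu> + \<nu> = Abs_vmeasure (\<lambda>E. measure_of_set \<mu> E + measure_of_set \<nu> E)"

definition scaleR_vmeasure :: "real \<Rightarrow> ('a, 'b) vmeasure \<Rightarrow> ('a, 'b) vmeasure"
  where "a *\<^sub>R \<mu> = Abs_vmeasure (\<lambda>E. a *\<^sub>R measure_of_set \<mu> E)"

definition uminus_vmeasure :: "('a, 'b) vmeasure \<Rightarrow> ('a, 'b) vmeasure"
  where "- \<mu> = Abs_vmeasure (\<lambda>E. - measure_of_set \<mu> E)"

definition minus_vmeasure :: "('a, 'b) vmeasure \<Rightarrow> ('a, 'b) vmeasure \<Rightarrow> ('a, 'b) vmeasure"
  where "\<mu> - \<nu> = Abs_vmeasure (\<lambda>E. measure_of_set \<mu> E + measure_of_set (- \<nu>) E)"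

lemma measure_of_set_zero [simp]: "measure_of_set (0 :: ('a, 'b) vmeasure) E = 0"
  by (simp add: zero_vmeasure_def Abs_vmeasure_inverse zero_regular_bv)

lemma measure_of_set_add [simp]:
  "measure_of_set (\<mu> + \<nu> :: ('a, 'b) vmeasure) E = measure_of_set \<mu> E + measure_of_set \<nu> E"
  by (simp add: plus_vmeasure_def Abs_vmeasure_inverse add_regular_bv measure_of_set)

lemma measure_of_set_scaleR [simp]:
  "measure_of_set (a *\<^sub>R \<mu> :: ('a, 'b) vmeasure) E = a *\<^sub>R measure_of_set \<mu> E"
  by (simp add: scaleR_vmeasure_def Abs_vmeasure_inverse
      image_regular_bv[OF bounded_linear_scaleR_right] measure_of_set)

lemma measure_of_set_uminus [simp]:
  "measure_of_set (- \<mu> :: ('a, 'b) vmeasure) E = - measure_of_set \<mu> E"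
  by (simp add: uminus_vmeasure_def Abs_vmeasure_inverse
      image_regular_bv[OF bounded_linear_minus[OF bounded_linear_ident]] measure_of_set)

lemma measure_of_set_diff [simp]:
  "measure_of_set (\<mu> - \<nu> :: ('a, 'b) vmeasure) E = measure_of_set \<mu> E - measure_of_set \<nu> E"
  unfolding minus_vmeasure_def
  by (subst Abs_vmeasure_inverse) (intro add_regular_bv measure_of_set, simp)

instance
proof
  fix \<mu> \<nu> \<rho> :: "('a, 'b) vmeasure" and a b :: real
  show "\<mu> + \<nu> + \<rho> = \<mu> + (\<nu> + \<rho>)" "\<mu> + \<nu> = \<nu> + \<mu>" "0 + \<mu> = \<mu>" "- \<mu> + \<mu> = 0"
    "\<mu> - \<nu> = \<mu> + - \<nu>"
    by (rule vmeasure_eqI; simp)+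
  show "a *\<^sub>R (\<mu> + \<nu>) = a *\<^sub>R \<mu> + a *\<^sub>R \<nu>" "(a + b) *\<^sub>R \<mu> = a *\<^sub>R \<mu> + b *\<^sub>R \<mu>"
    "a *\<^sub>R b *\<^sub>R \<mu> = (a * b) *\<^sub>R \<mu>" "1 *\<^sub>R \<mu> = \<mu>"
    by (rule vmeasure_eqI; simp add: scaleR_add_right scaleR_add_left)+
qed

end

instantiation vmeasure :: (topological_space, real_normed_vector) real_normed_vector
begin

definition norm_vmeasure :: "('a, 'b) vmeasure \<Rightarrow> real"
  where "norm \<mu> = enn2real (variation (measure_of_set \<mu>) UNIV)"

definition sgn_vmeasure :: "('a, 'b) vmeasure \<Rightarrow> ('a, 'b) vmeasure"
  where "sgn \<mu> = \<mu> /\<^sub>R norm (\<mu> :: ('a, 'b) vmeasure)"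

definition dist_vmeasure :: "('a, 'b) vmeasure \<Rightarrow> ('a, 'b) vmeasure \<Rightarrow> real"
  where "dist \<mu> \<nu> = norm (\<mu> - \<nu> :: ('a, 'b) vmeasure)"

definition uniformity_vmeasure :: "(('a, 'b) vmeasure \<times> ('a, 'b) vmeasure) filter"
  where "uniformity = (INF e\<in>{0<..}. principal {(x :: ('a, 'b) vmeasure, y). dist x y < e})"

definition open_vmeasure :: "('a, 'b) vmeasure set \<Rightarrow> bool"
  where "open_vmeasure S = (\<forall>x\<in>S. \<forall>\<^sub>F (x', y) in uniformity. x' = x \<longrightarrow> y \<in> S)"

lemma variation_finite: "variation (measure_of_set (\<mu> :: ('a, 'b) vmeasure)) UNIV < \<infinity>"
  using measure_of_set[of \<mu>] by (simp add: regular_bv_measures_def)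

instance
proof
  fix \<mu> \<nu> :: "('a, 'b) vmeasure" and a :: real
  show "dist \<mu> \<nu> = norm (\<mu> - \<nu>)" "sgn \<mu> = \<mu> /\<^sub>R norm \<mu>"
    by (simp_all add: dist_vmeasure_def sgn_vmeasure_def)
  show "uniformity = (INF e\<in>{0<..}. principal {(x :: ('a, 'b) vmeasure, y). dist x y < e})"
    by (rule uniformity_vmeasure_def)
  show "open S = (\<forall>x\<in>S. \<forall>\<^sub>F (x', y) in uniformity. x' = x \<longrightarrow> y \<in> S)"
    for S :: "('a, 'b) vmeasure set"
    by (rule open_vmeasure_def)
  show "norm \<mu> = 0 \<longleftrightarrow> \<mu> = 0"
  proof
    assume "norm \<mu> = 0"
    then have 0: "variation (measure_of_set \<mu>) UNIV = 0"
      using variation_finite[of \<mu>] by (auto simp: norm_vmeasure_def enn2real_eq_0_iff)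
    have "measure_of_set \<mu> E = 0" for E
    proof (cases "E \<in> sets borel")
      case True
      have "ennreal (norm (measure_of_set \<mu> E)) \<le> variation (measure_of_set \<mu>) UNIV"
        by (rule order_trans[OF norm_le_variation[OF True] variation_mono]) simp
      then show ?thesis by (simp add: 0)
    next
      case False
      then show ?thesis
        using measure_of_set[of \<mu>] by (simp add: regular_bv_measures_def)
    qed
    then show "\<mu> = 0" by (intro vmeasure_eqI) simp
  next
    assume "\<mu> = 0"
    then have "measure_of_set \<mu> = (\<lambda>_. 0)" by auto
    then show "norm \<mu> = 0"
      by (simp add: norm_vmeasure_def)
  qed
  have "measure_of_set (\<mu> + \<nu>) = (\<lambda>E. measure_of_set \<mu> E + measure_of_set \<nu> E)"
    by auto
  then have "variation (measure_of_set (\<mu> + \<nu>)) UNIV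
      \<le> variation (measure_of_set \<mu>) UNIV + variation (measure_of_set \<nu>) UNIV"
    by (simp add: variation_add)
  then have "norm (\<mu> + \<nu>)
      \<le> enn2real (variation (measure_of_set \<mu>) UNIV + variation (measure_of_set \<nu>) UNIV)"
    unfolding norm_vmeasure_def using variation_finite[of \<mu>] variation_finite[of \<nu>]
    by (intro enn2real_mono) auto
  also have "\<dots> = norm \<mu> + norm \<nu>"
    unfolding norm_vmeasure_def using variation_finite[of \<mu>] variation_finite[of \<nu>]
    by (intro enn2real_plus) auto
  finally show "norm (\<mu> + \<nu>) \<le> norm \<mu> + norm \<nu>" .
  have "measure_of_set (a *\<^sub>R \<mu>) = (\<lambda>E. a *\<^sub>R measure_of_set \<mu> E)"
    by auto
  then show "norm (a *\<^sub>R \<mu>) = \<bar>a\<bar> * norm \<mu>"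
    by (simp add: norm_vmeasure_def variation_scale[where k = "\<bar>a\<bar>"] enn2real_mult)
qed

end

instantiation vmeasure :: (topological_space, complex_normed_vector) complex_normed_vector
begin

definition scaleC_vmeasure :: "complex \<Rightarrow> ('a, 'b) vmeasure \<Rightarrow> ('a, 'b) vmeasure"
  where "c *\<^sub>C \<mu> = Abs_vmeasure (\<lambda>E. c *\<^sub>C measure_of_set \<mu> E)"

lemma measure_of_set_scaleC [simp]:
  "measure_of_set (c *\<^sub>C \<mu> :: ('a, 'b) vmeasure) E = c *\<^sub>C measure_of_set \<mu> E"
  by (simp add: scaleC_vmeasure_def Abs_vmeasure_inverse
      image_regular_bv[OF bounded_linear_scaleC] measure_of_set)

instance
proof
  fix \<mu> \<nu> :: "('a, 'b) vmeasure" and c d :: complex and a :: real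
  show "c *\<^sub>C (\<mu> + \<nu>) = c *\<^sub>C \<mu> + c *\<^sub>C \<nu>"
    by (rule vmeasure_eqI) (simp add: scaleC_add_right)
  show "(c + d) *\<^sub>C \<mu> = c *\<^sub>C \<mu> + d *\<^sub>C \<mu>"
    by (rule vmeasure_eqI) (simp add: scaleC_add_left)
  show "c *\<^sub>C d *\<^sub>C \<mu> = (c * d) *\<^sub>C \<mu>"
    by (rule vmeasure_eqI) (simp add: scaleC_scaleC)
  show "a *\<^sub>R \<mu> = complex_of_real a *\<^sub>C \<mu>"
    by (rule vmeasure_eqI) (simp add: scaleR_scaleC)
  have "measure_of_set (c *\<^sub>C \<mu>) = (\<lambda>E. c *\<^sub>C measure_of_set \<mu> E)"
    by auto
  then show "norm (c *\<^sub>C \<mu>) = cmod c * norm \<mu>"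
    by (simp add: norm_vmeasure_def variation_scale[where k = "cmod c"] norm_scaleC enn2real_mult)
qed

end


section \<open>Integration, convolution and the operator \<open>T\<^sub>f\<close>\<close>

definition simple_integral_wrt ::
    "('g::topological_space set \<Rightarrow> 'x::complex_normed_vector) \<Rightarrow> ('g \<Rightarrow> complex) \<Rightarrow> 'x"
  where "simple_integral_wrt m s = (\<Sum>c\<in>range s. c *\<^sub>C m (s -` {c}))"

text \<open>
  The integral of a bounded Borel function with respect to a vector measure of bounded variation:
  the common limit of the integrals of simple functions converging uniformly to it.
\<close>

definition integral_wrt ::
    "('g::topological_space set \<Rightarrow> 'x::complex_normed_vector) \<Rightarrow> ('g \<Rightarrow> complex) \<Rightarrow> 'x"
  where "integral_wrt m f = (THE y. \<forall>s. (\<forall>n. simple_function borel (s n)) \<longrightarrow>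
    uniform_limit UNIV s f sequentially \<longrightarrow> (\<lambda>n. simple_integral_wrt m (s n)) \<longlonglongrightarrow> y)"

text \<open>
  \<open>Bcontfun\<close> turns a bounded continuous function into an element of the function space.  For
  compact \<open>G\<close> the functions of \<open>g\<close> below are continuous, because \<open>g \<mapsto> f(g - \<cdot>)\<close> is continuous
  into \<open>C(G)\<close>.
\<close>

definition convolution ::
    "('g::topological_ab_group_add \<Rightarrow>\<^sub>C complex) \<Rightarrow> ('g, complex) vmeasure \<Rightarrow> 'g \<Rightarrow>\<^sub>C complex"
  where "convolution f \<mu> =
    Bcontfun (\<lambda>g. integral_wrt (measure_of_set \<mu>) (\<lambda>h. apply_bcontfun f (g - h)))"

definition vconvolution ::
    "('x::complex_normed_vector \<Rightarrow> 'y::complex_normed_vector) \<Rightarrow>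
      ('g::topological_ab_group_add \<Rightarrow>\<^sub>C complex) \<Rightarrow> ('g, 'x) vmeasure \<Rightarrow> 'g \<Rightarrow>\<^sub>C 'y"
  where "vconvolution T f \<mu> =
    Bcontfun (\<lambda>g. integral_wrt (\<lambda>E. T (measure_of_set \<mu> E)) (\<lambda>t. apply_bcontfun f (g - t)))"


section \<open>Hilbert spaces and Lorentz--Schatten classes\<close>

text \<open>
  To say that an operator factors through some Hilbert space, one has to quantify over Hilbert
  spaces, so these are structures with an explicit carrier instead of instances of a type class.
\<close>

record 'h cnspace =
  carrier :: "'h set"
  add :: "'h \<Rightarrow> 'h \<Rightarrow> 'h"
  scale :: "complex \<Rightarrow> 'h \<Rightarrow> 'h"
  nrm :: "'h \<Rightarrow> real"

record 'h hspace = "'h cnspace" +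
  zero :: 'h
  ip :: "'h \<Rightarrow> 'h \<Rightarrow> complex"

definition type_space :: "'z::complex_normed_vector cnspace"
  where "type_space = \<lparr>carrier = UNIV, add = (+), scale = (*\<^sub>C), nrm = norm\<rparr>"

definition bounded_operator ::
    "('a, 'm) cnspace_scheme \<Rightarrow> ('b, 'n) cnspace_scheme \<Rightarrow> ('a \<Rightarrow> 'b) \<Rightarrow> bool"
  where "bounded_operator V W T \<longleftrightarrow>
    (\<forall>x\<in>carrier V. T x \<in> carrier W) \<and>
    (\<forall>x\<in>carrier V. \<forall>y\<in>carrier V. T (add V x y) = add W (T x) (T y)) \<and>
    (\<forall>c. \<forall>x\<in>carrier V. T (scale V c x) = scale W c (T x)) \<and>
    (\<exists>k. \<forall>x\<in>carrier V. nrm W (T x) \<le> k * nrm V x)"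

definition hconverges :: "'h hspace \<Rightarrow> (nat \<Rightarrow> 'h) \<Rightarrow> 'h \<Rightarrow> bool"
  where "hconverges H u l \<longleftrightarrow> (\<lambda>n. nrm H (add H (u n) (scale H (-1) l))) \<longlonglongrightarrow> 0"

locale hilbert_space =
  fixes H :: "'h hspace"
  assumes zero_closed: "zero H \<in> carrier H"
    and add_closed: "\<lbrakk>x \<in> carrier H; y \<in> carrier H\<rbrakk> \<Longrightarrow> add H x y \<in> carrier H"
    and scale_closed: "x \<in> carrier H \<Longrightarrow> scale H c x \<in> carrier H"
    and add_assoc: "\<lbrakk>x \<in> carrier H; y \<in> carrier H; z \<in> carrier H\<rbrakk> \<Longrightarrow>
      add H (add H x y) z = add H x (add H y z)"
    and add_commute: "\<lbrakk>x \<in> carrier H; y \<in> carrier H\<rbrakk> \<Longrightarrow> add H x y = add H y x"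
    and add_zero: "x \<in> carrier H \<Longrightarrow> add H x (zero H) = x"
    and add_inverse: "x \<in> carrier H \<Longrightarrow> add H x (scale H (-1) x) = zero H"
    and scale_one: "x \<in> carrier H \<Longrightarrow> scale H 1 x = x"
    and scale_scale: "x \<in> carrier H \<Longrightarrow> scale H c (scale H d x) = scale H (c * d) x"
    and scale_add_left: "x \<in> carrier H \<Longrightarrow> scale H (c + d) x = add H (scale H c x) (scale H d x)"
    and scale_add_right: "\<lbrakk>x \<in> carrier H; y \<in> carrier H\<rbrakk> \<Longrightarrow>
      scale H c (add H x y) = add H (scale H c x) (scale H c y)"
    and ip_commute: "\<lbrakk>x \<in> carrier H; y \<in> carrier H\<rbrakk> \<Longrightarrow> ip H y x = cnj (ip H x y)"
    and ip_add_left: "\<lbrakk>x \<in> carrier H; y \<in> carrier H; z \<in> carrier H\<rbrakk> \<Longrightarrow>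
      ip H (add H x y) z = ip H x z + ip H y z"
    and ip_scale_left: "\<lbrakk>x \<in> carrier H; y \<in> carrier H\<rbrakk> \<Longrightarrow> ip H (scale H c x) y = c * ip H x y"
    and ip_nonneg: "x \<in> carrier H \<Longrightarrow> 0 \<le> Re (ip H x x)"
    and ip_definite: "\<lbrakk>x \<in> carrier H; ip H x x = 0\<rbrakk> \<Longrightarrow> x = zero H"
    and nrm_ip: "x \<in> carrier H \<Longrightarrow> nrm H x = sqrt (Re (ip H x x))"
    and complete: "\<lbrakk>\<forall>n. u n \<in> carrier H;
      \<forall>\<epsilon>>0. \<exists>N. \<forall>m\<ge>N. \<forall>n\<ge>N. nrm H (add H (u m) (scale H (-1) (u n))) < \<epsilon>\<rbrakk> \<Longrightarrow>
      \<exists>l\<in>carrier H. hconverges H u l"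

definition compact_operator :: "'h hspace \<Rightarrow> ('h \<Rightarrow> 'h) \<Rightarrow> bool"
  where "compact_operator H U \<longleftrightarrow> bounded_operator H H U \<and>
    (\<forall>u. (\<forall>n. u n \<in> carrier H \<and> nrm H (u n) \<le> 1) \<longrightarrow>
      (\<exists>\<phi>. strict_mono (\<phi> :: nat \<Rightarrow> nat) \<and>
        (\<exists>l\<in>carrier H. hconverges H (\<lambda>n. U (u (\<phi> n))) l)))"

definition hadjoint :: "'h hspace \<Rightarrow> ('h \<Rightarrow> 'h) \<Rightarrow> 'h \<Rightarrow> 'h"
  where "hadjoint H U y = (THE z. z \<in> carrier H \<and> (\<forall>x\<in>carrier H. ip H (U x) y = ip H x z))"

definition eigenspace :: "'h hspace \<Rightarrow> ('h \<Rightarrow> 'h) \<Rightarrow> complex \<Rightarrow> 'h set"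
  where "eigenspace H U c = {x \<in> carrier H. U x = scale H c x}"

definition orthonormal_basis :: "'h hspace \<Rightarrow> 'h set \<Rightarrow> 'h set \<Rightarrow> bool"
  where "orthonormal_basis H V B \<longleftrightarrow> B \<subseteq> V \<and>
    (\<forall>x\<in>B. \<forall>y\<in>B. ip H x y = (if x = y then 1 else 0)) \<and>
    (\<forall>x\<in>V. (\<forall>b\<in>B. ip H x b = 0) \<longrightarrow> x = zero H)"

text \<open>
  The singular numbers of a compact operator \<open>U\<close> are the eigenvalues of \<open>(U\<^sup>* U)\<^sup>1\<^sup>/\<^sup>2\<close> in
  decreasing order: every \<open>t > 0\<close> occurs as often as the multiplicity of \<open>t\<^sup>2\<close> as an eigenvalue
  of \<open>U\<^sup>* U\<close> (the dimension of the eigenspace, hence \<open>0\<close> times if \<open>t\<^sup>2\<close> is not an eigenvalue);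
  the sequence is continued by zeros if there are only finitely many positive terms.
\<close>

definition singular_numbers :: "'h hspace \<Rightarrow> ('h \<Rightarrow> 'h) \<Rightarrow> (nat \<Rightarrow> real) \<Rightarrow> bool"
  where "singular_numbers H U \<sigma> \<longleftrightarrow> decseq \<sigma> \<and> (\<forall>n. 0 \<le> \<sigma> n) \<and>
    (\<forall>t>0. \<exists>e. inj_on e {n. \<sigma> n = t} \<and>
      orthonormal_basis H (eigenspace H (\<lambda>x. hadjoint H U (U x)) (complex_of_real (t\<^sup>2)))
        (e ` {n. \<sigma> n = t}))"

text \<open>
  The sequence is indexed from \<open>0\<close>, so \<open>\<sigma> n\<close> is the singular number with index \<open>n + 1\<close>.
\<close>

definition lorentz_schatten :: "ereal \<Rightarrow> ereal \<Rightarrow> 'h hspace \<Rightarrow> ('h \<Rightarrow> 'h) set"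
  where "lorentz_schatten r s H =
    (if r = \<infinity> \<and> s = \<infinity> then {U. bounded_operator H H U}
     else {U. compact_operator H U \<and> (\<exists>\<sigma>. singular_numbers H U \<sigma> \<and>
       summable (\<lambda>n. real (Suc n) powr (real_of_ereal s / real_of_ereal r - 1) *
         \<sigma> n powr real_of_ereal s))})"

text \<open>
  HOL cannot quantify over types inside a formula, so the Hilbert space ranges over all Hilbert
  spaces whose carrier is a subset of a type \<open>'h\<close>, which plays the role of a universe: every
  Hilbert space is one of these for some \<open>'h\<close>.  No restriction on \<open>'h\<close> is ever assumed.
\<close>

definition factors_through_S ::
    "'h itself \<Rightarrow> ereal \<Rightarrow> ereal \<Rightarrow> ('z::complex_normed_vector \<Rightarrow> 'w::complex_normed_vector) \<Rightarrow> bool"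
  where "factors_through_S TYPE('h) r s S \<longleftrightarrow>
    (\<exists>(H :: 'h hspace) U A B. hilbert_space H \<and> U \<in> lorentz_schatten r s H \<and>
      bounded_operator type_space H A \<and> bounded_operator H type_space B \<and>
      S = (\<lambda>z. B (U (A z))))"

end

theory Submission
  imports Defs
begin

text \<open>
  Factorizations survive composition with bounded operators on either side, so it suffices to
  recover both operators from \<open>T\<^sub>f\<close>.  Evaluating \<open>T\<^sub>f\<close> on \<open>\<delta>\<^sub>0 \<otimes> x\<close> at a point where \<open>f\<close> does not
  vanish gives a nonzero multiple of \<open>T x\<close>.  Fixing \<open>x\<close> with \<open>T x \<noteq> 0\<close> and a functional \<open>\<phi>\<close> with
  \<open>\<phi> (T x) = 1\<close>, the operator \<open>\<mu> \<mapsto> \<phi> \<circ> T\<^sub>f (\<mu> \<otimes> x)\<close> is convolution by \<open>f\<close>.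
\<close>

text \<open>The operators are built from descriptions: \<open>integral_wrt\<close> is a
  \<open>THE\<close>, and \<open>Bcontfun\<close> is meaningful only on bounded continuous
  functions. Most of the work is therefore to establish what \<open>vconvolution T f\<close> does on
  the few measures that are used. On an elementary tensor its values are a scalar function in C(G)
  times the fixed vector \<open>T x\<close>, so continuity only has to be proved for scalar
  measures, where compactness of the group provides it. The functional on Y comes from a Hahn-Banach
  argument for complex normed spaces, with minimal sublinear functionals in place of extension from
  subspaces. In a factorization the Hilbert space and its middle operator stay as they are and only
  the two outer maps change, so the Lorentz-Schatten condition is inherited in both ranges of r and
  s.\<close>

lemma scaleC_zero_right: "c *\<^sub>C (0 :: 'a::complex_normed_vector) = 0"
  using norm_scaleC[of c "0 :: 'a"] by simp

lemma scaleC_one: "1 *\<^sub>C x = (x :: 'a::complex_normed_vector)"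
  using scaleR_scaleC[of 1 x] by simp


section \<open>Bounded functionals\<close>

text \<open>Homogeneity is required only as an inequality, which is easier to check for infima;
  equality follows by scaling back with \<open>inverse a\<close>.\<close>

definition sublinear :: "('a::real_vector \<Rightarrow> real) \<Rightarrow> bool"
  where "sublinear q \<longleftrightarrow> (\<forall>x y. q (x + y) \<le> q x + q y) \<and> (\<forall>a\<ge>0. \<forall>x. q (a *\<^sub>R x) \<le> a * q x)"

lemma sublinear_add: "sublinear q \<Longrightarrow> q (x + y) \<le> q x + q y"
  by (simp add: sublinear_def)

lemma sublinear_zero:
  assumes "sublinear q"
  shows "q 0 = 0"
proof -
  have "q (0 *\<^sub>R 0) \<le> 0 * q 0" "q (0 + 0) \<le> q 0 + q 0"
    using assms unfolding sublinear_def by blast+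
  then show ?thesis by simp
qed

lemma sublinear_scale:
  assumes "sublinear q" "a \<ge> 0"
  shows "q (a *\<^sub>R x) = a * q x"
proof (cases "a = 0")
  case True
  then show ?thesis using sublinear_zero[OF assms(1)] by simp
next
  case False
  have "q (a *\<^sub>R x) \<le> a * q x"
    using assms by (simp add: sublinear_def)
  moreover have "q (inverse a *\<^sub>R (a *\<^sub>R x)) \<le> inverse a * q (a *\<^sub>R x)"
    using assms unfolding sublinear_def by (meson inverse_nonnegative_iff_nonnegative)
  then have "a * q x \<le> q (a *\<^sub>R x)"
    using False assms by (simp add: field_simps)
  ultimately show ?thesis by simp
qed

lemma sublinear_neg: "sublinear q \<Longrightarrow> - q (- x) \<le> q x"
  using sublinear_add[of q x "- x"] sublinear_zero[of q] by simp

text \<open>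
  The Hahn--Banach argument: the functional below lies under \<open>q\<close>, so it equals a minimal \<open>q\<close>, and
  \<open>t = 1\<close> then gives \<open>q x + q y \<le> q (x + y)\<close>.  Hence minimal sublinear functionals are linear.
\<close>

lemma sublinear_directional:
  assumes q: "sublinear q"
  defines "q' \<equiv> \<lambda>y x. INF t\<in>{0..}. q (x + t *\<^sub>R y) - t * q y"
  shows "sublinear (q' y)" and "t \<ge> 0 \<Longrightarrow> q' y x \<le> q (x + t *\<^sub>R y) - t * q y"
proof -
  \<comment> \<open>The lower bound comes from \<open>t * q y = q (t *\<^sub>R y)\<close> and
    subadditivity applied to \<open>t *\<^sub>R y = (x + t *\<^sub>R y) + (- x)\<close>.\<close>
  have bdd: "bdd_below ((\<lambda>t. q (x + t *\<^sub>R y) - t * q y) ` {0..})" for x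
  proof (rule bdd_belowI2)
    fix t :: real assume "t \<in> {0..}"
    then show "- q (- x) \<le> q (x + t *\<^sub>R y) - t * q y"
      using sublinear_add[OF q, of "x + t *\<^sub>R y" "- x"] sublinear_scale[OF q, of t y] by simp
  qed
  have q'_eq: "q' y x = (INF t\<in>{0..}. q (x + t *\<^sub>R y) - t * q y)" for x
    by (simp add: q'_def)
  have le: "q' y x \<le> q (x + t *\<^sub>R y) - t * q y" if "t \<ge> 0" for x t
    unfolding q'_eq using that by (intro cINF_lower[OF bdd]) auto
  then show "t \<ge> 0 \<Longrightarrow> q' y x \<le> q (x + t *\<^sub>R y) - t * q y" .
  show "sublinear (q' y)"
    unfolding sublinear_def
  proof (intro conjI allI impI)
    fix x z
    \<comment> \<open>The parameters t and u are merged into t + u; afterwards the infimum is taken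
      over u with t fixed, and then over t.\<close>
    have *: "q' y (x + z) \<le> (q (x + t *\<^sub>R y) - t * q y) + (q (z + u *\<^sub>R y) - u * q y)"
      if "t \<ge> 0" "u \<ge> 0" for t u
    proof -
      have "q' y (x + z) \<le> q ((x + z) + (t + u) *\<^sub>R y) - (t + u) * q y"
        using that by (intro le) simp
      also have "(x + z) + (t + u) *\<^sub>R y = (x + t *\<^sub>R y) + (z + u *\<^sub>R y)"
        by (simp add: algebra_simps)
      finally show ?thesis
        using sublinear_add[OF q, of "x + t *\<^sub>R y" "z + u *\<^sub>R y"] by (simp add: algebra_simps)
    qed
    have "q' y (x + z) - (q (x + t *\<^sub>R y) - t * q y) \<le> q' y z" if "t \<ge> 0" for t
      unfolding q'_eq[of z] using *[OF that]
      by (intro cINF_greatest) (auto simp: algebra_simps)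
    then have "q' y (x + z) - q' y z \<le> q (x + t *\<^sub>R y) - t * q y" if "t \<ge> 0" for t
      using that by (simp add: algebra_simps)
    then have "q' y (x + z) - q' y z \<le> (INF t\<in>{0..}. q (x + t *\<^sub>R y) - t * q y)"
      by (intro cINF_greatest) auto
    then show "q' y (x + z) \<le> q' y x + q' y z"
      by (simp add: q'_eq[of x])
  next
    fix a :: real and x assume a: "a \<ge> 0"
    show "q' y (a *\<^sub>R x) \<le> a * q' y x"
    proof (cases "a = 0")
      case True
      then show ?thesis using le[of 0 0] sublinear_zero[OF q] by simp
    next
      case False
      have "q' y (a *\<^sub>R x) / a \<le> (INF t\<in>{0..}. q (x + t *\<^sub>R y) - t * q y)"
      proof (rule cINF_greatest)
        fix t :: real assume t: "t \<in> {0..}"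
        have "q' y (a *\<^sub>R x) \<le> q (a *\<^sub>R x + (a * t) *\<^sub>R y) - (a * t) * q y"
          using a t by (intro le) simp
        also have "a *\<^sub>R x + (a * t) *\<^sub>R y = a *\<^sub>R (x + t *\<^sub>R y)"
          by (simp add: algebra_simps)
        also have "q \<dots> = a * q (x + t *\<^sub>R y)"
          by (rule sublinear_scale[OF q a])
        finally show "q' y (a *\<^sub>R x) / a \<le> q (x + t *\<^sub>R y) - t * q y"
          using a False by (simp add: field_simps)
      qed simp
      then show ?thesis
        using a False by (simp add: q'_eq[of x] field_simps)
    qed
  qed
qed

text \<open>Zorn's lemma applies because the pointwise infimum of a nonempty chain of sublinear
  functionals below p is again sublinear.\<close>

lemma minimal_sublinear_exists:
  assumes p: "sublinear p"
  obtains q where "sublinear q" "q \<le> p" "\<And>q'. sublinear q' \<Longrightarrow> q' \<le> q \<Longrightarrow> q' = q"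
proof -
  define S where "S = {q. sublinear q \<and> q \<le> p}"
  have "\<exists>m\<in>S. \<forall>a\<in>S. a \<le> m \<longrightarrow> a = m"
  \<comment> \<open>The order is reversed: maximal elements become minimal functionals, and upper
    bounds of chains become lower bounds.\<close>
  proof (rule predicate_Zorn[where P = "\<lambda>a b. b \<le> a"])
    show "partial_order_on S (relation_of (\<lambda>a b. b \<le> a) S)"
      by (rule partial_order_on_relation_ofI) auto
    fix C assume C: "C \<in> Chains (relation_of (\<lambda>a b. b \<le> a) S)"
    have CS: "C \<subseteq> S" by (rule Chains_relation_of[OF C])
    have total: "a \<le> b \<or> b \<le> a" if "a \<in> C" "b \<in> C" for a b
      using C that unfolding Chains_def relation_of_def by auto
    show "\<exists>u\<in>S. \<forall>a\<in>C. u \<le> a"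
    proof (cases "C = {}")
      case True
      then show ?thesis using p by (auto simp: S_def)
    next
      case False
      define u where "u x = (INF q\<in>C. q x)" for x
      \<comment> \<open>For q in the chain, \<open>q x\<close> is at least \<open>- q (- x)\<close>,
        hence at least \<open>- p (- x)\<close>, a bound independent of q.\<close>
      have bdd: "bdd_below ((\<lambda>q. q x) ` C)" for x
      proof (rule bdd_belowI2)
        fix q assume "q \<in> C"
        then have "sublinear q" "q (- x) \<le> p (- x)"
          using CS by (auto simp: S_def le_fun_def)
        then show "- p (- x) \<le> q x"
          using sublinear_neg[of q x] by simp
      qed
      have le: "u x \<le> q x" if "q \<in> C" for q x
        unfolding u_def using that by (intro cINF_lower bdd)
      have "sublinear u"
        unfolding sublinear_def
      proof (intro conjI allI impI)
        fix x y
        \<comment> \<open>The two infima on the right may be approached by different members of the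
          chain; the smaller of the two members serves for both.\<close>
        have *: "u (x + y) \<le> q x + q' y" if q: "q \<in> C" "q' \<in> C" for q q'
        proof -
          obtain r where r: "r \<in> C" "r \<le> q" "r \<le> q'"
            using total[OF q] q by blast
          have "u (x + y) \<le> r (x + y)" by (rule le[OF r(1)])
          also have "\<dots> \<le> r x + r y"
            using r CS by (intro sublinear_add) (auto simp: S_def)
          also have "\<dots> \<le> q x + q' y"
            using r by (intro add_mono) (auto simp: le_fun_def)
          finally show ?thesis .
        qed
        have "u (x + y) - q x \<le> u y" if "q \<in> C" for q
          unfolding u_def[of y] using *[OF that] False
          by (intro cINF_greatest) (auto simp: algebra_simps)
        then have "u (x + y) - u y \<le> u x"
          unfolding u_def[of x] using False by (intro cINF_greatest) (auto simp: algebra_simps)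
        then show "u (x + y) \<le> u x + u y" by simp
      next
        fix a :: real and x assume a: "a \<ge> 0"
        have *: "u (a *\<^sub>R x) \<le> a * q x" if "q \<in> C" for q
          using le[OF that, of "a *\<^sub>R x"] CS that sublinear_scale[of q a x] a by (auto simp: S_def)
        show "u (a *\<^sub>R x) \<le> a * u x"
        proof (cases "a = 0")
          case True
          then show ?thesis using * False by auto
        next
          case False
          then have "u (a *\<^sub>R x) / a \<le> u x"
            unfolding u_def[of x] using * a \<open>C \<noteq> {}\<close>
            by (intro cINF_greatest) (auto simp: field_simps)
          then show ?thesis
            using a False by (simp add: field_simps)
        qed
      qed
      moreover have "u \<le> p"
      proof -
        obtain q where "q \<in> C" using False by blast
        then have "u \<le> q" "q \<le> p" using le CS by (auto simp: le_fun_def S_def)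
        then show ?thesis by (rule order_trans)
      qed
      ultimately show ?thesis
        using le by (auto simp: S_def le_fun_def)
    qed
  qed
  then obtain m where m: "m \<in> S" "\<And>a. a \<in> S \<Longrightarrow> a \<le> m \<Longrightarrow> a = m" by blast
  show thesis
  proof (rule that[of m])
    show "q' = m" if "sublinear q'" "q' \<le> m" for q'
      using m that by (auto simp: S_def intro: order_trans)
  qed (use m in \<open>auto simp: S_def\<close>)
qed

lemma linear_below_sublinear:
  assumes "sublinear p"
  obtains u where "linear u" "\<And>x. u x \<le> p x"
proof -
  obtain u where u: "sublinear u" "u \<le> p" "\<And>q. sublinear q \<Longrightarrow> q \<le> u \<Longrightarrow> q = u"
    using minimal_sublinear_exists[OF assms] by metis
  have add: "u (x + y) = u x + u y" for x y
  proof -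
    define q where "q = (\<lambda>x. INF t\<in>{0..}. u (x + t *\<^sub>R y) - t * u y)"
    have q: "sublinear q" "\<And>t x. t \<ge> 0 \<Longrightarrow> q x \<le> u (x + t *\<^sub>R y) - t * u y"
      unfolding q_def using sublinear_directional[OF u(1)] by blast+
    have "q \<le> u"
      using q(2)[of 0] by (simp add: le_fun_def)
    then have "q = u"
      using u(3) q(1) by blast
    then have "u x \<le> u (x + y) - u y"
      using q(2)[of 1 x] by simp
    then show ?thesis
      using sublinear_add[OF u(1), of x y] by simp
  qed
  \<comment> \<open>Additivity makes u odd, which carries positive homogeneity over to negative
    scalars.\<close>
  have neg: "u (- x) = - u x" for x
    using add[of x "- x"] sublinear_zero[OF u(1)] by simp
  have "linear u"
  proof (rule linearI)
    fix a x
    show "u (a *\<^sub>R x) = a *\<^sub>R u x"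
    proof (cases "a \<ge> 0")
      case True
      then show ?thesis by (simp add: sublinear_scale[OF u(1)])
    next
      case False
      then show ?thesis
        using sublinear_scale[OF u(1), of "- a" x] neg[of "a *\<^sub>R x"] by simp
    qed
  qed (rule add)
  then show thesis
    using u(2) that by (auto simp: le_fun_def)
qed

text \<open>Starting from the norm made directional along y, no extension from the line through y is
  needed: t = 1 forces \<open>u (- y) \<le> - norm y\<close>, and t = 0 keeps u below the
  norm.\<close>

lemma real_functional_exists:
  fixes y :: "'a::real_normed_vector"
  assumes "y \<noteq> 0"
  obtains u :: "'a \<Rightarrow> real" where "linear u" "\<And>x. \<bar>u x\<bar> \<le> norm x" "u y \<noteq> 0"
proof -
  have norm: "sublinear (norm :: 'a \<Rightarrow> real)"
    by (simp add: sublinear_def norm_triangle_ineq)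
  define p where "p = (\<lambda>x. INF t\<in>{0..}. norm (x + t *\<^sub>R y) - t * norm y)"
  have p: "sublinear p" "\<And>t x. t \<ge> 0 \<Longrightarrow> p x \<le> norm (x + t *\<^sub>R y) - t * norm y"
    unfolding p_def using sublinear_directional[OF norm] by blast+
  obtain u where u: "linear u" "\<And>x. u x \<le> p x"
    using linear_below_sublinear[OF p(1)] by blast
  have le: "u x \<le> norm x" for x
    using u(2)[of x] p(2)[of 0 x] by simp
  have "u (- y) \<le> - norm y"
    using u(2)[of "- y"] p(2)[of 1 "- y"] by simp
  then have "u y \<noteq> 0"
    using assms linear_neg[OF u(1), of y] by auto
  moreover have "\<bar>u x\<bar> \<le> norm x" for x
    using le[of x] le[of "- x"] linear_neg[OF u(1), of x] by (simp add: abs_le_iff)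
  ultimately show thesis
    using that u(1) by blast
qed

text \<open>The usual complexification \<open>u x - \<i> * u (\<i> *\<^sub>C x)\<close> of a real
  functional is complex linear, and its real part at y is \<open>u y\<close>, which is nonzero;
  dividing by its value at y normalizes it. The crude norm bound 2 suffices.\<close>

lemma complex_functional_exists:
  fixes y :: "'a::complex_normed_vector"
  assumes "y \<noteq> 0"
  obtains \<phi> :: "'a \<Rightarrow> complex" where "bounded_clinear \<phi>" "\<phi> y = 1"
proof -
  obtain u :: "'a \<Rightarrow> real" where u: "linear u" "\<And>x. \<bar>u x\<bar> \<le> norm x" "u y \<noteq> 0"
    using real_functional_exists[OF assms] by blast
  note lin = linear_add[OF u(1)] linear_scale[OF u(1)]
  define \<psi> where "\<psi> x = complex_of_real (u x) - \<i> * complex_of_real (u (\<i> *\<^sub>C x))" for x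
  have add: "\<psi> (x + z) = \<psi> x + \<psi> z" for x z
    by (simp add: \<psi>_def lin scaleC_add_right algebra_simps)
  have real: "\<psi> (complex_of_real a *\<^sub>C x) = complex_of_real a * \<psi> x" for a x
  proof -
    have "\<i> *\<^sub>C complex_of_real a *\<^sub>C x = a *\<^sub>R (\<i> *\<^sub>C x)"
      by (simp add: scaleC_scaleC scaleR_scaleC mult.commute)
    then show ?thesis
      by (simp add: \<psi>_def lin algebra_simps flip: scaleR_scaleC)
  qed
  have imag: "\<psi> (\<i> *\<^sub>C x) = \<i> * \<psi> x" for x
  proof -
    have "\<i> *\<^sub>C \<i> *\<^sub>C x = (- 1) *\<^sub>R x"
      by (simp add: scaleC_scaleC scaleR_scaleC del: scaleR_minus_left)
    then have "u (\<i> *\<^sub>C \<i> *\<^sub>C x) = - u x"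
      by (simp add: linear_neg[OF u(1)])
    then show ?thesis
      by (simp add: \<psi>_def algebra_simps)
  qed
  have scale: "\<psi> (c *\<^sub>C x) = c * \<psi> x" for c x
  proof -
    have "c *\<^sub>C x = complex_of_real (Re c) *\<^sub>C x + \<i> *\<^sub>C complex_of_real (Im c) *\<^sub>C x"
      by (simp add: scaleC_scaleC flip: scaleC_add_left complex_eq)
    then have "\<psi> (c *\<^sub>C x) = (complex_of_real (Re c) + \<i> * complex_of_real (Im c)) * \<psi> x"
      by (simp add: add real imag algebra_simps)
    then show ?thesis by (simp flip: complex_eq)
  qed
  have bound: "norm (\<psi> x) \<le> norm x * 2" for x
  proof -
    have "norm (\<psi> x) \<le> \<bar>u x\<bar> + \<bar>u (\<i> *\<^sub>C x)\<bar>"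
      unfolding \<psi>_def by (rule order_trans[OF norm_triangle_ineq4]) (simp add: norm_mult)
    also have "\<dots> \<le> norm x + norm (\<i> *\<^sub>C x)"
      by (intro add_mono u)
    finally show ?thesis by (simp add: norm_scaleC)
  qed
  have "Re (\<psi> y) = u y" by (simp add: \<psi>_def)
  then have "\<psi> y \<noteq> 0" using u(3) by auto
  show thesis
  proof (rule that[of "\<lambda>x. \<psi> x / \<psi> y"])
    have "\<psi> (a *\<^sub>R x) = a *\<^sub>R \<psi> x" for a x
      by (simp add: scaleR_scaleC[of a x] scale scaleR_conv_of_real)
    then have "bounded_linear \<psi>"
      using bound by (intro bounded_linear_intro[where K = 2] add)
    then show "bounded_clinear (\<lambda>x. \<psi> x / \<psi> y)"
      unfolding bounded_clinear_def
      by (auto intro: bounded_linear_divide[THEN bounded_linear_compose]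
          simp: scale scaleC_complex_def)
  qed (use \<open>\<psi> y \<noteq> 0\<close> in simp)
qed


section \<open>Integration\<close>

lemma regular_bv_sums:
  assumes "m \<in> regular_bv_measures" "range A \<subseteq> sets borel" "disjoint_family A"
  shows "(\<lambda>n. m (A n)) sums m (\<Union>n. A n)"
  using assms by (simp add: regular_bv_measures_def)

text \<open>Countably many copies of the empty set are disjoint, so a series with constant term
  \<open>m {}\<close> converges and its terms tend to 0.\<close>

lemma regular_bv_empty:
  assumes "m \<in> regular_bv_measures"
  shows "m {} = 0"
proof -
  have "(\<lambda>_::nat. m {}) sums m {}"
    using regular_bv_sums[OF assms, of "\<lambda>_. {}"] by (simp add: disjoint_family_on_def)
  then have "(\<lambda>_::nat. m {}) \<longlonglongrightarrow> 0"
    by (intro summable_LIMSEQ_zero sums_summable)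
  then show ?thesis by (simp add: LIMSEQ_const_iff)
qed

lemma regular_bv_Un:
  assumes m: "m \<in> regular_bv_measures" and "A \<in> sets borel" "B \<in> sets borel" "A \<inter> B = {}"
  shows "m (A \<union> B) = m A + m B"
proof -
  have "range (binaryset A B) \<subseteq> sets borel" "disjoint_family (binaryset A B)"
    using assms by (auto simp: range_binaryset_eq disjoint_family_on_def binaryset_def)
  then have "(\<lambda>n. m (binaryset A B n)) sums m (\<Union>n. binaryset A B n)"
    by (rule regular_bv_sums[OF m])
  moreover have "(\<lambda>n. m (binaryset A B n)) sums (\<Sum>n\<in>{0,1}. m (binaryset A B n))"
    by (rule sums_finite) (auto simp: binaryset_def regular_bv_empty[OF m])
  ultimately show ?thesis
    by (auto simp: UN_binaryset_eq binaryset_def dest: sums_unique2)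
qed

lemma regular_bv_finite_Union:
  assumes m: "m \<in> regular_bv_measures" and "finite I" "\<And>i. i \<in> I \<Longrightarrow> A i \<in> sets borel"
    "disjoint_family_on A I"
  shows "m (\<Union>i\<in>I. A i) = (\<Sum>i\<in>I. m (A i))"
  using assms(2-)
proof (induction I rule: finite_induct)
  case empty
  then show ?case by (simp add: regular_bv_empty[OF m])
next
  case (insert i I)
  have "A i \<inter> (\<Union>j\<in>I. A j) = {}"
    using insert by (auto simp: disjoint_family_on_def)
  then have "m (A i \<union> (\<Union>j\<in>I. A j)) = m (A i) + m (\<Union>j\<in>I. A j)"
    using insert by (intro regular_bv_Un[OF m] sets.finite_UN) auto
  moreover have "disjoint_family_on A I"
    using insert by (auto simp: disjoint_family_on_def)
  ultimately show ?case
    using insert by simp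
qed

text \<open>The level sets of \<open>\<phi> \<circ> u\<close> are finite unions of those of u, so
  its integral may be computed over the finer family. With a pair-valued u this puts two simple
  functions on common level sets.\<close>

lemma simple_integral_wrt_comp:
  assumes m: "m \<in> regular_bv_measures" and u: "simple_function borel u"
  shows "simple_integral_wrt m (\<lambda>x. \<phi> (u x)) = (\<Sum>p\<in>range u. \<phi> p *\<^sub>C m (u -` {p}))"
proof -
  have fin: "finite (range u)" and sets: "\<And>p. p \<in> range u \<Longrightarrow> u -` {p} \<in> sets borel"
    using u by (auto simp: simple_function_def)
  have "simple_integral_wrt m (\<lambda>x. \<phi> (u x)) =
      (\<Sum>c\<in>\<phi> ` range u. c *\<^sub>C m ((\<lambda>x. \<phi> (u x)) -` {c}))"
    by (simp add: simple_integral_wrt_def image_image)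
  also have "\<dots> = (\<Sum>c\<in>\<phi> ` range u. \<Sum>p\<in>{p \<in> range u. \<phi> p = c}. \<phi> p *\<^sub>C m (u -` {p}))"
  proof (rule sum.cong[OF refl])
    fix c
    have "(\<lambda>x. \<phi> (u x)) -` {c} = (\<Union>p\<in>{p \<in> range u. \<phi> p = c}. u -` {p})"
      by auto
    also have "m \<dots> = (\<Sum>p\<in>{p \<in> range u. \<phi> p = c}. m (u -` {p}))"
      using fin sets by (intro regular_bv_finite_Union[OF m]) (auto simp: disjoint_family_on_def)
    finally show "c *\<^sub>C m ((\<lambda>x. \<phi> (u x)) -` {c}) =
        (\<Sum>p\<in>{p \<in> range u. \<phi> p = c}. \<phi> p *\<^sub>C m (u -` {p}))"
      by (simp add: linear_sum[OF bounded_linear.linear[OF bounded_linear_scaleC]])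
  qed
  also have "\<dots> = (\<Sum>p\<in>range u. \<phi> p *\<^sub>C m (u -` {p}))"
    by (rule sum.image_gen[OF fin, symmetric])
  finally show ?thesis .
qed

text \<open>The level sets of u form one of the finite disjoint families over which the variation is
  a supremum. Distinct values in the range have distinct level sets, so summing over values or over
  sets is the same.\<close>

lemma sum_norm_le_variation:
  assumes m: "m \<in> regular_bv_measures" and u: "simple_function borel u"
  shows "(\<Sum>p\<in>range u. norm (m (u -` {p}))) \<le> enn2real (variation m UNIV)"
proof -
  have fin: "finite (range u)" and sets: "\<And>p. p \<in> range u \<Longrightarrow> u -` {p} \<in> sets borel"
    using u by (auto simp: simple_function_def)
  have "inj_on (\<lambda>p. u -` {p}) (range u)"
    by (auto simp: inj_on_def)
  then have "(\<Sum>p\<in>range u. ennreal (norm (m (u -` {p})))) =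
      (\<Sum>A\<in>(\<lambda>p. u -` {p}) ` range u. ennreal (norm (m A)))"
    by (simp add: sum.reindex)
  also have "\<dots> \<le> variation m UNIV"
    unfolding variation_def
    by (rule SUP_upper) (use fin sets in \<open>auto simp: disj_families_def disjoint_def\<close>)
  finally have "ennreal (\<Sum>p\<in>range u. norm (m (u -` {p}))) \<le> variation m UNIV"
    by (simp add: sum_nonneg)
  then have "enn2real (ennreal (\<Sum>p\<in>range u. norm (m (u -` {p})))) \<le> enn2real (variation m UNIV)"
    using m by (intro enn2real_mono) (auto simp: regular_bv_measures_def)
  then show ?thesis by (simp add: sum_nonneg)
qed

text \<open>On the level sets of the pair \<open>(s, t)\<close> the two coefficients differ by at
  most \<epsilon>, and the norms of m over these sets add up to at most the total variation.\<close>

lemma norm_simple_integral_wrt_diff_le: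
  fixes m :: "'g::topological_space set \<Rightarrow> 'x::complex_normed_vector"
  assumes m: "m \<in> regular_bv_measures" and s: "simple_function borel s" and t: "simple_function borel t"
    and le: "\<And>x. cmod (s x - t x) \<le> \<epsilon>"
  shows "norm (simple_integral_wrt m s - simple_integral_wrt m t) \<le> \<epsilon> * enn2real (variation m UNIV)"
proof -
  define u where "u = (\<lambda>x. (s x, t x))"
  have u: "simple_function borel u"
    unfolding u_def using s t by (rule simple_function_Pair)
  have "simple_integral_wrt m s = (\<Sum>p\<in>range u. fst p *\<^sub>C m (u -` {p}))"
    using simple_integral_wrt_comp[OF m u, of fst] by (simp add: u_def)
  moreover have "simple_integral_wrt m t = (\<Sum>p\<in>range u. snd p *\<^sub>C m (u -` {p}))"
    using simple_integral_wrt_comp[OF m u, of snd] by (simp add: u_def)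
  moreover have "fst p *\<^sub>C v - snd p *\<^sub>C v = (fst p - snd p) *\<^sub>C v" for p and v :: 'x
    using scaleC_add_left[of "fst p - snd p" "snd p" v] by simp
  ultimately have "norm (simple_integral_wrt m s - simple_integral_wrt m t)
      = norm (\<Sum>p\<in>range u. (fst p - snd p) *\<^sub>C m (u -` {p}))"
    by (simp flip: sum_subtractf)
  also have "\<dots> \<le> (\<Sum>p\<in>range u. \<epsilon> * norm (m (u -` {p})))"
  proof (rule sum_norm_le)
    fix p assume "p \<in> range u"
    then have "cmod (fst p - snd p) \<le> \<epsilon>"
      using le by (auto simp: u_def)
    then show "norm ((fst p - snd p) *\<^sub>C m (u -` {p})) \<le> \<epsilon> * norm (m (u -` {p}))"
      by (simp add: norm_scaleC mult_right_mono)
  qed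
  also have "\<dots> \<le> \<epsilon> * enn2real (variation m UNIV)"
    unfolding sum_distrib_left[symmetric]
    using sum_norm_le_variation[OF m u] order_trans[OF norm_ge_zero le]
    by (rule mult_left_mono)
  finally show ?thesis .
qed

text \<open>Real and imaginary parts are rounded down to multiples of \<open>1 / Suc n\<close>.
  Boundedness leaves only finitely many grid values, and the two rounding errors together give
  \<open>2 / Suc n\<close>.\<close>

lemma simple_approximation:
  fixes f :: "'g::topological_space \<Rightarrow> complex"
  assumes f: "f \<in> borel_measurable borel" and bounded: "bounded (range f)"
  obtains s where "\<And>n. simple_function borel (s n)" "uniform_limit UNIV s f sequentially"
proof -
  define s where "s n x = Complex (of_int \<lfloor>real (Suc n) * Re (f x)\<rfloor> / real (Suc n))
    (of_int \<lfloor>real (Suc n) * Im (f x)\<rfloor> / real (Suc n))" for n x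
  obtain b where b: "\<And>x. cmod (f x) \<le> b"
    using bounded by (auto simp: bounded_iff)
  have simple: "simple_function borel (s n)" for n
  proof -
    have *: "simple_function borel (\<lambda>x. \<lfloor>real (Suc n) * h x\<rfloor>)"
      if h: "h \<in> borel_measurable borel" and hb: "\<And>x. \<bar>h x\<bar> \<le> b" for h :: "'g \<Rightarrow> real"
    proof -
      have meas: "(\<lambda>x. \<lfloor>real (Suc n) * h x\<rfloor>) \<in> measurable borel (count_space UNIV)"
        using h by measurable
      have "\<lfloor>real (Suc n) * h x\<rfloor> \<in> {\<lfloor>- (real (Suc n) * b)\<rfloor>..\<lfloor>real (Suc n) * b\<rfloor>}" for x
      proof -
        have "\<bar>real (Suc n) * h x\<bar> \<le> real (Suc n) * b"
          unfolding abs_mult using hb[of x] by (intro mult_mono) auto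
        then show ?thesis by (auto simp: abs_le_iff intro!: floor_mono)
      qed
      then have "range (\<lambda>x. \<lfloor>real (Suc n) * h x\<rfloor>) \<subseteq>
          {\<lfloor>- (real (Suc n) * b)\<rfloor>..\<lfloor>real (Suc n) * b\<rfloor>}"
        by blast
      then have "finite (range (\<lambda>x. \<lfloor>real (Suc n) * h x\<rfloor>))"
        by (rule finite_subset) simp
      then show ?thesis
        unfolding simple_function_def using measurable_sets[OF meas] by auto
    qed
    have "simple_function borel (\<lambda>x. (\<lfloor>real (Suc n) * Re (f x)\<rfloor>, \<lfloor>real (Suc n) * Im (f x)\<rfloor>))"
      using f b abs_Re_le_cmod abs_Im_le_cmod
      by (intro simple_function_Pair *) (auto intro: order_trans)
    from simple_function_compose1[OF this, of "\<lambda>(p, q). Complex (of_int p / real (Suc n)) (of_int q / real (Suc n))"]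
    show ?thesis
      by (simp add: s_def[abs_def])
  qed
  have dist: "dist (s n x) (f x) \<le> 2 / real (Suc n)" for n x
  proof -
    have fl: "\<bar>of_int \<lfloor>real (Suc n) * a\<rfloor> / real (Suc n) - a\<bar> \<le> 1 / real (Suc n)" for a
    proof -
      have "of_int \<lfloor>real (Suc n) * a\<rfloor> / real (Suc n) - a =
          (of_int \<lfloor>real (Suc n) * a\<rfloor> - real (Suc n) * a) / real (Suc n)"
        by (simp add: diff_divide_distrib)
      moreover have "\<bar>of_int \<lfloor>real (Suc n) * a\<rfloor> - real (Suc n) * a\<bar> \<le> 1"
        by linarith
      ultimately show ?thesis
        by (simp add: abs_divide divide_right_mono)
    qed
    have "cmod (s n x - f x) \<le> \<bar>Re (s n x - f x)\<bar> + \<bar>Im (s n x - f x)\<bar>"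
      by (rule cmod_le)
    also have "\<dots> \<le> 1 / real (Suc n) + 1 / real (Suc n)"
      unfolding s_def using fl[of "Re (f x)"] fl[of "Im (f x)"] by (intro add_mono) auto
    finally show ?thesis by (simp add: dist_norm)
  qed
  have "uniform_limit UNIV s f sequentially"
  proof (rule uniform_limitI)
    fix e :: real assume "e > 0"
    have "(\<lambda>n. 2 / real (Suc n)) \<longlonglongrightarrow> 0"
      by (rule LIMSEQ_Suc[OF lim_const_over_n])
    then have "eventually (\<lambda>n. 2 / real (Suc n) < e) sequentially"
      using \<open>e > 0\<close> by (rule order_tendstoD)
    then show "\<forall>\<^sub>F n in sequentially. \<forall>x\<in>UNIV. dist (s n x) (f x) < e"
      by eventually_elim (use dist in \<open>auto intro: le_less_trans\<close>)
  qed
  with simple show thesis by (rule that)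
qed

text \<open>The condition under the \<open>THE\<close> of \<open>integral_wrt\<close>, separated as
  a relation so that a candidate value can be verified, or carried over to another measure,
  directly.\<close>

definition has_integral_wrt ::
    "('g::topological_space set \<Rightarrow> 'x::complex_normed_vector) \<Rightarrow> ('g \<Rightarrow> complex) \<Rightarrow> 'x \<Rightarrow> bool"
  where "has_integral_wrt m f y \<longleftrightarrow> (\<forall>s. (\<forall>n. simple_function borel (s n)) \<longrightarrow>
    uniform_limit UNIV s f sequentially \<longrightarrow> (\<lambda>n. simple_integral_wrt m (s n)) \<longlonglongrightarrow> y)"

text \<open>An approximating sequence of simple functions exists, so the defining condition is not
  vacuous and uniqueness of limits determines the value.\<close>

lemma integral_wrt_eqI:
  assumes "f \<in> borel_measurable borel" "bounded (range f)" and y: "has_integral_wrt m f y"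
  shows "integral_wrt m f = y"
proof -
  obtain s where s: "\<And>n. simple_function borel (s n)" "uniform_limit UNIV s f sequentially"
    using simple_approximation[OF assms(1,2)] by blast
  show ?thesis
    unfolding integral_wrt_def
  proof (rule the_equality)
    show "\<forall>s. (\<forall>n. simple_function borel (s n)) \<longrightarrow> uniform_limit UNIV s f sequentially \<longrightarrow>
        (\<lambda>n. simple_integral_wrt m (s n)) \<longlonglongrightarrow> y"
      using y by (simp add: has_integral_wrt_def)
    fix z assume "\<forall>s. (\<forall>n. simple_function borel (s n)) \<longrightarrow> uniform_limit UNIV s f sequentially \<longrightarrow>
        (\<lambda>n. simple_integral_wrt m (s n)) \<longlonglongrightarrow> z"
    then show "z = y"
      using s y unfolding has_integral_wrt_def by (meson LIMSEQ_unique)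
  qed
qed

lemma has_integral_wrt_integral:
  fixes m :: "'g::topological_space set \<Rightarrow> 'x::complex_banach"
  assumes f: "f \<in> borel_measurable borel" "bounded (range f)" and m: "m \<in> regular_bv_measures"
  shows "has_integral_wrt m f (integral_wrt m f)"
proof -
  define V where "V = enn2real (variation m UNIV)"
  have V: "V \<ge> 0" by (simp add: V_def)
  \<comment> \<open>Two sequences are compared at once: with equal sequences this is the Cauchy
    property, with different ones it shows that the limit does not depend on the choice.\<close>
  have cauchy: "\<exists>N. \<forall>n\<ge>N. \<forall>k\<ge>N. norm (simple_integral_wrt m (s n) - simple_integral_wrt m (t k)) < e"
    if s: "\<And>n. simple_function borel (s n)" "uniform_limit UNIV s f sequentially"
      and t: "\<And>n. simple_function borel (t n)" "uniform_limit UNIV t f sequentially"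
      and e: "e > 0" for s t :: "nat \<Rightarrow> 'g \<Rightarrow> complex" and e :: real
  proof -
    \<comment> \<open>Both sequences are within d of f, so the integrals differ by at most
      \<open>2 * d * V\<close>. Dividing by \<open>V + 1\<close> instead of V covers the case V =
      0.\<close>
    define d where "d = e / (V + 1) / 2"
    have d: "d > 0" using e V by (simp add: d_def)
    obtain N1 where N1: "\<And>n x. n \<ge> N1 \<Longrightarrow> dist (s n x) (f x) < d"
      using uniform_limitD[OF s(2) d] by (auto simp: eventually_sequentially)
    obtain N2 where N2: "\<And>n x. n \<ge> N2 \<Longrightarrow> dist (t n x) (f x) < d"
      using uniform_limitD[OF t(2) d] by (auto simp: eventually_sequentially)
    have "norm (simple_integral_wrt m (s n) - simple_integral_wrt m (t k)) < e"
      if n: "n \<ge> max N1 N2" and k: "k \<ge> max N1 N2" for n k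
    proof -
      have "cmod (s n x - t k x) \<le> 2 * d" for x
      proof -
        have "dist (s n x) (t k x) \<le> dist (s n x) (f x) + dist (t k x) (f x)"
          by (rule dist_triangle2)
        then show ?thesis
          using N1[of n x] N2[of k x] n k by (simp add: dist_norm)
      qed
      then have "norm (simple_integral_wrt m (s n) - simple_integral_wrt m (t k)) \<le> 2 * d * V"
        unfolding V_def by (intro norm_simple_integral_wrt_diff_le m s t)
      also have "\<dots> < 2 * d * (V + 1)" using d by simp
      also have "2 * d = e / (V + 1)"
        unfolding d_def mult_2 by (rule field_sum_of_halves)
      also have "e / (V + 1) * (V + 1) = e" using V by simp
      finally show ?thesis .
    qed
    then show ?thesis by blast
  qed
  obtain t where t: "\<And>n. simple_function borel (t n)" "uniform_limit UNIV t f sequentially"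
    using simple_approximation[OF f] by blast
  have "Cauchy (\<lambda>n. simple_integral_wrt m (t n))"
    by (rule CauchyI) (use cauchy[OF t t] in blast)
  then obtain y where y: "(\<lambda>n. simple_integral_wrt m (t n)) \<longlonglongrightarrow> y"
    using Cauchy_convergent convergent_def by blast
  have "has_integral_wrt m f y"
    unfolding has_integral_wrt_def
  proof (intro allI impI)
    fix s assume s: "\<forall>n. simple_function borel (s n)" "uniform_limit UNIV s f sequentially"
    have "(\<lambda>n. simple_integral_wrt m (s n) - simple_integral_wrt m (t n)) \<longlonglongrightarrow> 0"
    proof (rule LIMSEQ_I)
      fix e :: real assume "e > 0"
      then show "\<exists>N. \<forall>n\<ge>N. norm (simple_integral_wrt m (s n) - simple_integral_wrt m (t n) - 0) < e"
        using cauchy[OF s(1)[rule_format] s(2) t] by fastforce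
    qed
    from tendsto_add[OF this y] show "(\<lambda>n. simple_integral_wrt m (s n)) \<longlonglongrightarrow> y" by simp
  qed
  with integral_wrt_eqI[OF f this] show ?thesis by simp
qed

lemma norm_has_integral_wrt_diff_le:
  assumes m: "m \<in> regular_bv_measures"
    and f: "f \<in> borel_measurable borel" "bounded (range f)" "has_integral_wrt m f y"
    and g: "g \<in> borel_measurable borel" "bounded (range g)" "has_integral_wrt m g z"
    and le: "\<And>x. cmod (f x - g x) \<le> \<epsilon>"
  shows "norm (y - z) \<le> \<epsilon> * enn2real (variation m UNIV)"
proof -
  obtain s where s: "\<And>n. simple_function borel (s n)" "uniform_limit UNIV s f sequentially"
    using simple_approximation[OF f(1,2)] by blast
  obtain t where t: "\<And>n. simple_function borel (t n)" "uniform_limit UNIV t g sequentially"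
    using simple_approximation[OF g(1,2)] by blast
  have lim: "(\<lambda>n. norm (simple_integral_wrt m (s n) - simple_integral_wrt m (t n))) \<longlonglongrightarrow> norm (y - z)"
    using f(3) g(3) s t unfolding has_integral_wrt_def by (intro tendsto_intros) auto
  \<comment> \<open>Each approximating function costs an error d, hence
    \<open>\<epsilon> + 2 * d\<close>; the error is removed at the end by letting d tend to
    0.\<close>
  have "norm (y - z) \<le> (\<epsilon> + 2 * d) * enn2real (variation m UNIV)" if d: "d > 0" for d
  proof (rule tendsto_upperbound[OF lim])
    show "\<forall>\<^sub>F n in sequentially. norm (simple_integral_wrt m (s n) - simple_integral_wrt m (t n))
        \<le> (\<epsilon> + 2 * d) * enn2real (variation m UNIV)"
      using uniform_limitD[OF s(2) d] uniform_limitD[OF t(2) d]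
    proof eventually_elim
      case (elim n)
      have "cmod (s n x - t n x) \<le> \<epsilon> + 2 * d" for x
      proof -
        have "cmod (s n x - t n x) = cmod ((s n x - f x) + (f x - g x) - (t n x - g x))"
          by simp
        also have "\<dots> \<le> cmod (s n x - f x) + cmod (f x - g x) + cmod (t n x - g x)"
          by (rule order_trans[OF norm_triangle_ineq4 add_right_mono[OF norm_triangle_ineq]])
        finally have "cmod (s n x - t n x)
            \<le> cmod (s n x - f x) + cmod (f x - g x) + cmod (t n x - g x)" .
        moreover have "cmod (s n x - f x) < d" "cmod (t n x - g x) < d"
          using elim by (auto simp: dist_norm)
        ultimately show ?thesis
          using le[of x] by linarith
      qed
      then show ?case
        by (intro norm_simple_integral_wrt_diff_le m s t)
    qed
  qed simp
  then have "\<forall>\<^sub>F d in at_right 0. norm (y - z) \<le> (\<epsilon> + 2 * d) * enn2real (variation m UNIV)"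
    using eventually_at_right_less[of "0 :: real"] by (simp add: eventually_mono)
  moreover have "((\<lambda>d. (\<epsilon> + 2 * d) * enn2real (variation m UNIV)) \<longlongrightarrow>
      (\<epsilon> + 2 * 0) * enn2real (variation m UNIV)) (at_right 0)"
    by (intro tendsto_intros)
  ultimately have "norm (y - z) \<le> (\<epsilon> + 2 * 0) * enn2real (variation m UNIV)"
    by (intro tendsto_lowerbound) auto
  then show ?thesis by simp
qed

section \<open>Integrals against a scalar measure times a fixed vector\<close>

lemma bounded_linear_scaleC_left: "bounded_linear (\<lambda>c. c *\<^sub>C (v :: 'x::complex_normed_vector))"
  by (rule bounded_linear_intro[where K = "norm v"])
    (auto simp: scaleC_add_left norm_scaleC scaleR_scaleC scaleC_scaleC scaleC_complex_def)

lemma has_integral_wrt_scaleC_right: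
  assumes "has_integral_wrt m f y"
  shows "has_integral_wrt (\<lambda>E. m E *\<^sub>C v) f (y *\<^sub>C v)"
  unfolding has_integral_wrt_def
proof (intro allI impI)
  fix s assume s: "\<forall>n. simple_function borel (s n)" "uniform_limit UNIV s f sequentially"
  have "simple_integral_wrt (\<lambda>E. m E *\<^sub>C v) (s n) = simple_integral_wrt m (s n) *\<^sub>C v" for n
    by (simp add: simple_integral_wrt_def linear_sum[OF bounded_linear.linear[OF bounded_linear_scaleC_left]]
        scaleC_scaleC scaleC_complex_def)
  then show "(\<lambda>n. simple_integral_wrt (\<lambda>E. m E *\<^sub>C v) (s n)) \<longlonglongrightarrow> y *\<^sub>C v"
    using assms s by (auto simp: has_integral_wrt_def intro!: bounded_linear.tendsto[OF bounded_linear_scaleC_left])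
qed


section \<open>Elementary tensors\<close>

text \<open>The vector point mass \<open>\<delta>\<^sub>a \<otimes> x\<close>; the test for Borel
  sets follows the convention that measures vanish on all other sets.\<close>

definition point_measure :: "'g \<Rightarrow> 'x \<Rightarrow> 'g::topological_space set \<Rightarrow> 'x::real_normed_vector"
  where "point_measure a x E = (if E \<in> sets borel \<and> a \<in> E then x else 0)"

text \<open>At most one member of a disjoint family contains the point a.\<close>

lemma variation_point_measure_le:
  "variation (point_measure a x) E \<le> (if a \<in> E then ennreal (norm x) else 0)"
  unfolding variation_def
proof (rule SUP_least)
  fix P assume P: "P \<in> disj_families E"
  show "(\<Sum>A\<in>P. ennreal (norm (point_measure a x A))) \<le> (if a \<in> E then ennreal (norm x) else 0)"
  proof (cases "\<exists>A\<in>P. a \<in> A")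
    case True
    then obtain A where A: "A \<in> P" "a \<in> A" by blast
    then have "a \<notin> B" if "B \<in> P - {A}" for B
      using P that by (auto simp: disj_families_def disjoint_def)
    then have "(\<Sum>B\<in>P - {A}. ennreal (norm (point_measure a x B))) = 0"
      by (intro sum.neutral) (auto simp: point_measure_def)
    then have "(\<Sum>B\<in>P. ennreal (norm (point_measure a x B))) = ennreal (norm (point_measure a x A))"
      using P A by (subst sum.remove[of _ A]) (auto simp: disj_families_def)
    also have "\<dots> \<le> ennreal (norm x)"
      by (auto simp: point_measure_def)
    finally show ?thesis
      using P A by (auto simp: disj_families_def)
  next
    case False
    then have "(\<Sum>A\<in>P. ennreal (norm (point_measure a x A))) = 0"
      by (intro sum.neutral) (auto simp: point_measure_def)
    then show ?thesis by simp
  qed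
qed

lemma point_measure_regular_bv:
  "point_measure (a :: 'g::t2_space) x \<in> regular_bv_measures"
  unfolding regular_bv_measures_def
proof (intro CollectI conjI allI impI ballI)
  fix A :: "nat \<Rightarrow> 'g set" assume A: "range A \<subseteq> sets borel" "disjoint_family A"
  show "(\<lambda>n. point_measure a x (A n)) sums point_measure a x (\<Union>n. A n)"
  proof (cases "\<exists>n. a \<in> A n")
    case True
    then obtain k where k: "a \<in> A k" by blast
    have "a \<notin> A n" if "n \<noteq> k" for n
      using A(2) k that by (auto simp: disjoint_family_on_def)
    then have "(\<lambda>n. point_measure a x (A n)) sums (\<Sum>n\<in>{k}. point_measure a x (A n))"
      by (intro sums_finite) (auto simp: point_measure_def)
    then show ?thesis
      using A(1) k by (auto simp: point_measure_def)
  next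
    case False
    then show ?thesis by (simp add: point_measure_def)
  qed
next
  show "variation (point_measure a x) UNIV < \<infinity>"
    by (rule le_less_trans[OF variation_point_measure_le]) simp
next
  fix E :: "'g set" and \<epsilon> :: real assume "\<epsilon> > 0"
  have null: "variation (point_measure a x) F < ennreal \<epsilon>" if "a \<notin> F" for F
    using variation_point_measure_le[of a x F] that \<open>\<epsilon> > 0\<close> by simp
  show "\<exists>K V. compact K \<and> open V \<and> K \<subseteq> E \<and> E \<subseteq> V \<and>
      variation (point_measure a x) (V - K) < ennreal \<epsilon>"
  \<comment> \<open>It is enough that \<open>V - K\<close> misses a: the point is put into K if it
    lies in E and is removed from V otherwise. Points are closed in a Hausdorff space.\<close>
  proof (cases "a \<in> E")
    case True
    then show ?thesis
      by (intro exI[of _ "{a}"] exI[of _ UNIV]) (auto intro: null)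
  next
    case False
    then show ?thesis
      by (intro exI[of _ "{}"] exI[of _ "- {a}"]) (auto intro: null)
  qed
qed (simp add: point_measure_def)

text \<open>Among the level sets of a simple function only the one through a can carry mass, and
  uniform convergence includes convergence at a.\<close>

lemma has_integral_wrt_point_measure: "has_integral_wrt (point_measure a x) f (f a *\<^sub>C x)"
  unfolding has_integral_wrt_def
proof (intro allI impI)
  fix s assume s: "\<forall>n. simple_function borel (s n)" "uniform_limit UNIV s f sequentially"
  have "simple_integral_wrt (point_measure a x) (s n) = s n a *\<^sub>C x" for n
  proof -
    have fin: "finite (range (s n))" and sets: "\<And>p. p \<in> range (s n) \<Longrightarrow> s n -` {p} \<in> sets borel"
      using s(1)[rule_format, of n] by (auto simp: simple_function_def)
    have "simple_integral_wrt (point_measure a x) (s n) =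
        (\<Sum>c\<in>range (s n). if c = s n a then s n a *\<^sub>C x else 0)"
      unfolding simple_integral_wrt_def
      using sets by (intro sum.cong) (auto simp: point_measure_def scaleC_zero_right)
    then show ?thesis using fin by simp
  qed
  moreover have "(\<lambda>n. s n a) \<longlonglongrightarrow> f a"
    using s(2) by (rule tendsto_uniform_limitI) simp
  ultimately show "(\<lambda>n. simple_integral_wrt (point_measure a x) (s n)) \<longlonglongrightarrow> f a *\<^sub>C x"
    by (auto intro!: bounded_linear.tendsto[OF bounded_linear_scaleC_left])
qed

definition point_vmeasure :: "'g \<Rightarrow> 'x \<Rightarrow> ('g::t2_space, 'x::real_normed_vector) vmeasure"
  where "point_vmeasure a x = Abs_vmeasure (point_measure a x)"

lemma measure_of_set_point_vmeasure [simp]: "measure_of_set (point_vmeasure a x) = point_measure a x"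
  by (simp add: point_vmeasure_def Abs_vmeasure_inverse point_measure_regular_bv)

definition tensor_vmeasure ::
    "('g::topological_space, complex) vmeasure \<Rightarrow> 'x::complex_normed_vector \<Rightarrow> ('g, 'x) vmeasure"
  where "tensor_vmeasure \<mu> x = Abs_vmeasure (\<lambda>E. measure_of_set \<mu> E *\<^sub>C x)"

lemma measure_of_set_tensor_vmeasure [simp]:
  "measure_of_set (tensor_vmeasure \<mu> x) E = measure_of_set \<mu> E *\<^sub>C x"
  by (simp add: tensor_vmeasure_def Abs_vmeasure_inverse image_regular_bv[OF bounded_linear_scaleC_left]
      measure_of_set)

section \<open>The bounded maps placed on either side of the vector convolution\<close>

lemma bounded_operator_type_spaceI:
  assumes "\<And>x y. S (x + y) = S x + S y" "\<And>c x. S (c *\<^sub>C x) = c *\<^sub>C S x"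
    "\<And>x. norm (S x) \<le> k * norm x"
  shows "bounded_operator type_space type_space S"
  using assms by (auto simp: bounded_operator_def type_space_def)

lemma bounded_operator_point_vmeasure:
  "bounded_operator type_space type_space
    (point_vmeasure a :: 'x::complex_normed_vector \<Rightarrow> ('g::t2_space, 'x) vmeasure)"
proof (rule bounded_operator_type_spaceI[where k = 1])
  fix x y :: 'x and c
  show "point_vmeasure a (x + y) = point_vmeasure a x + point_vmeasure a y"
    "point_vmeasure a (c *\<^sub>C x) = c *\<^sub>C point_vmeasure a x"
    by (auto intro!: vmeasure_eqI simp: point_measure_def scaleC_zero_right)
  have "variation (point_measure a x) UNIV \<le> ennreal (norm x)"
    using variation_point_measure_le[of a x UNIV] by simp
  then have "enn2real (variation (point_measure a x) UNIV) \<le> enn2real (ennreal (norm x))"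
    by (intro enn2real_mono) auto
  then show "norm (point_vmeasure a x) \<le> 1 * norm x"
    by (simp add: norm_vmeasure_def)
qed

lemma bounded_operator_tensor_vmeasure:
  "bounded_operator type_space type_space
    (\<lambda>\<mu> :: ('g::topological_space, complex) vmeasure. tensor_vmeasure \<mu> x)"
proof (rule bounded_operator_type_spaceI[where k = "norm x"])
  fix \<mu> \<nu> :: "('g, complex) vmeasure" and c
  show "tensor_vmeasure (\<mu> + \<nu>) x = tensor_vmeasure \<mu> x + tensor_vmeasure \<nu> x"
    "tensor_vmeasure (c *\<^sub>C \<mu>) x = c *\<^sub>C tensor_vmeasure \<mu> x"
    by (auto intro!: vmeasure_eqI simp: scaleC_add_left scaleC_scaleC scaleC_complex_def)
  have "measure_of_set (tensor_vmeasure \<mu> x) = (\<lambda>E. measure_of_set \<mu> E *\<^sub>C x)"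
    by auto
  then have "norm (tensor_vmeasure \<mu> x)
      = enn2real (ennreal (norm x) * variation (measure_of_set \<mu>) UNIV)"
    by (simp add: norm_vmeasure_def norm_scaleC mult.commute
        variation_scale[where T = "\<lambda>c. c *\<^sub>C x" and k = "norm x"])
  then show "norm (tensor_vmeasure \<mu> x) \<le> norm x * norm \<mu>"
    by (simp add: norm_vmeasure_def enn2real_mult)
qed

text \<open>Postcomposition with \<phi>, which leads from C(G, Y) back to scalar functions.\<close>

lemma bounded_operator_comp_bcontfun:
  fixes \<phi> :: "'y::complex_normed_vector \<Rightarrow> 'z::complex_normed_vector"
  assumes "bounded_clinear \<phi>"
  obtains C :: "('g::topological_space \<Rightarrow>\<^sub>C 'y) \<Rightarrow> 'g \<Rightarrow>\<^sub>C 'z"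
    where "bounded_operator type_space type_space C"
      "\<And>h g. apply_bcontfun (C h) g = \<phi> (apply_bcontfun h g)"
proof -
  have \<phi>: "bounded_linear \<phi>" "\<And>c y. \<phi> (c *\<^sub>C y) = c *\<^sub>C \<phi> y"
    using assms by (auto simp: bounded_clinear_def)
  obtain k where k: "k > 0" "\<And>y. norm (\<phi> y) \<le> k * norm y"
    using bounded_linear.pos_bounded[OF \<phi>(1)] by (metis mult.commute)
  have le: "norm (\<phi> (apply_bcontfun h g)) \<le> k * norm h" for h :: "'g \<Rightarrow>\<^sub>C 'y" and g
    using k norm_bounded[of h g] by (meson mult_left_mono order_trans less_imp_le)
  define C where "C h = Bcontfun (\<lambda>g. \<phi> (apply_bcontfun h g))" for h :: "'g \<Rightarrow>\<^sub>C 'y"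
  have apply_C: "apply_bcontfun (C h) g = \<phi> (apply_bcontfun h g)" for h g
  proof -
    have "(\<lambda>g. \<phi> (apply_bcontfun h g)) \<in> bcontfun"
      by (rule bcontfun_normI[OF _ le]) (intro bounded_linear.continuous_on[OF \<phi>(1)], simp)
    then show ?thesis
      by (simp add: C_def Bcontfun_inverse)
  qed
  have "bounded_operator type_space type_space C"
  proof (rule bounded_operator_type_spaceI[where k = k])
    show "norm (C h) \<le> k * norm h" for h
      by (rule norm_bound) (simp add: apply_C le)
  qed (auto intro!: bcontfun_eqI simp: apply_C \<phi> linear_add[OF bounded_linear.linear[OF \<phi>(1)]])
  with apply_C show thesis using that by blast
qed

lemma bounded_operator_scaled_evaluation:
  "bounded_operator type_space type_space (\<lambda>h. c *\<^sub>C apply_bcontfun h g)"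
  by (rule bounded_operator_type_spaceI[where k = "cmod c"])
    (auto simp: scaleC_add_right scaleC_scaleC norm_scaleC mult.commute norm_bounded mult_left_mono)


section \<open>Convolution\<close>

lemma translate_measurable_bounded:
  fixes f :: "'g::topological_ab_group_add \<Rightarrow>\<^sub>C complex"
  shows "(\<lambda>h. apply_bcontfun f (g - h)) \<in> borel_measurable borel"
    and "bounded (range (\<lambda>h. apply_bcontfun f (g - h)))"
proof -
  show "(\<lambda>h. apply_bcontfun f (g - h)) \<in> borel_measurable borel"
    by (intro borel_measurable_continuous_onI continuous_on_compose2[OF continuous_on_apply_bcontfun[of UNIV]]
        continuous_on_op_minus subset_UNIV)
  show "bounded (range (\<lambda>h. apply_bcontfun f (g - h)))"
    by (rule bounded_subset[OF bounded_apply_bcontfun[of f]]) auto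
qed

text \<open>\<open>Bcontfun\<close> can be undone once the integral is known to be continuous in g.
  It is, because g and g' whose translates of f are uniformly close have integrals that differ by at
  most that distance times the variation; boundedness then follows from compactness.\<close>

lemma apply_convolution:
  fixes f :: "'g::topological_ab_group_add \<Rightarrow>\<^sub>C complex"
  assumes "compact (UNIV :: 'g set)"
  shows "apply_bcontfun (convolution f \<mu>) g =
    integral_wrt (measure_of_set \<mu>) (\<lambda>h. apply_bcontfun f (g - h))"
proof -
  define I where "I g = integral_wrt (measure_of_set \<mu>) (\<lambda>h. apply_bcontfun f (g - h))" for g
  define V where "V = enn2real (variation (measure_of_set \<mu>) UNIV)"
  have V: "V \<ge> 0" by (simp add: V_def)
  have I: "has_integral_wrt (measure_of_set \<mu>) (\<lambda>h. apply_bcontfun f (g - h)) (I g)" for g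
    unfolding I_def by (intro has_integral_wrt_integral translate_measurable_bounded measure_of_set)
  have diff: "norm (I g - I g') \<le> \<epsilon> * V"
    if "\<And>h. cmod (apply_bcontfun f (g - h) - apply_bcontfun f (g' - h)) \<le> \<epsilon>" for g g' \<epsilon>
    unfolding V_def
    using that by (intro norm_has_integral_wrt_diff_le[OF measure_of_set translate_measurable_bounded I
          translate_measurable_bounded I])
  have cont: "continuous_on UNIV (\<lambda>p :: 'g \<times> 'g. apply_bcontfun f (fst p - snd p))"
    by (intro continuous_on_compose2[OF continuous_on_apply_bcontfun[of UNIV]]) (auto intro!: continuous_intros)
  have "(I \<longlongrightarrow> I g) (at g)" for g
  proof (rule tendstoI)
    fix e :: real assume e: "e > 0"
    define d where "d = e / (V + 1)"
    have d: "d > 0" using e V by (simp add: d_def)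
    \<comment> \<open>Compactness in the second variable gives one neighbourhood of g that works for
      all h simultaneously.\<close>
    obtain X where X: "g \<in> X" "open X"
        "\<forall>x\<in>X \<inter> UNIV. \<forall>h\<in>UNIV. dist (apply_bcontfun f (fst (x, h) - snd (x, h)))
          (apply_bcontfun f (fst (g, h) - snd (g, h))) \<le> d"
      using continuous_on_prod_compactE[of UNIV UNIV "\<lambda>p. apply_bcontfun f (fst p - snd p)" g d]
        cont assms d by auto
    have "dist (I x) (I g) < e" if "x \<in> X" for x
    proof -
      have "norm (I x - I g) \<le> d * V"
        using X(3) that by (intro diff) (auto simp: dist_norm)
      also have "\<dots> < d * (V + 1)" using d by simp
      also have "\<dots> = e" using V by (simp add: d_def)
      finally show ?thesis by (simp add: dist_norm)
    qed
    with X show "\<forall>\<^sub>F x in at g. dist (I x) (I g) < e"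
      by (auto simp: eventually_at_topological)
  qed
  then have continuous: "continuous_on UNIV I"
    by (simp add: continuous_on_def)
  have "bounded (range I)"
    using compact_continuous_image[OF continuous assms] by (rule compact_imp_bounded)
  with continuous have "I \<in> bcontfun"
    by (simp add: bcontfun_def)
  then show ?thesis
    by (simp add: convolution_def I_def[abs_def] Bcontfun_inverse)
qed

text \<open>If the integrals are \<open>k g *\<^sub>C v\<close> with k already in C(G), the
  integrand of \<open>Bcontfun\<close> is visibly bounded and continuous, so the vector-valued case
  needs no separate continuity argument.\<close>

lemma vconvolution_eqI:
  fixes f :: "'g::topological_ab_group_add \<Rightarrow>\<^sub>C complex"
  assumes "\<And>g. has_integral_wrt (\<lambda>E. T (measure_of_set \<mu> E)) (\<lambda>h. apply_bcontfun f (g - h))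
    (apply_bcontfun k g *\<^sub>C v)"
  shows "apply_bcontfun (vconvolution T f \<mu>) g = apply_bcontfun k g *\<^sub>C v"
proof -
  have "(\<lambda>g. apply_bcontfun k g *\<^sub>C v) \<in> bcontfun"
  proof (rule bcontfun_normI[where b = "norm k * norm v"])
    show "continuous_on UNIV (\<lambda>g. apply_bcontfun k g *\<^sub>C v)"
      by (intro bounded_linear.continuous_on[OF bounded_linear_scaleC_left]) simp
    show "norm (apply_bcontfun k g *\<^sub>C v) \<le> norm k * norm v" for g
      by (simp add: norm_scaleC norm_bounded mult_right_mono)
  qed
  moreover have "integral_wrt (\<lambda>E. T (measure_of_set \<mu> E)) (\<lambda>h. apply_bcontfun f (g - h)) =
      apply_bcontfun k g *\<^sub>C v" for g
    by (intro integral_wrt_eqI translate_measurable_bounded assms)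
  ultimately show ?thesis
    by (simp add: vconvolution_def Bcontfun_inverse)
qed

lemma vconvolution_tensor:
  fixes f :: "'g::topological_ab_group_add \<Rightarrow>\<^sub>C complex"
  assumes "compact (UNIV :: 'g set)" "bounded_clinear T"
  shows "apply_bcontfun (vconvolution T f (tensor_vmeasure \<mu> x)) g =
    apply_bcontfun (convolution f \<mu>) g *\<^sub>C T x"
proof (rule vconvolution_eqI)
  fix g
  have "has_integral_wrt (measure_of_set \<mu>) (\<lambda>h. apply_bcontfun f (g - h))
      (apply_bcontfun (convolution f \<mu>) g)"
    unfolding apply_convolution[OF assms(1)]
    by (intro has_integral_wrt_integral translate_measurable_bounded measure_of_set)
  from has_integral_wrt_scaleC_right[OF this, of "T x"] assms(2)
  show "has_integral_wrt (\<lambda>E. T (measure_of_set (tensor_vmeasure \<mu> x) E)) (\<lambda>h. apply_bcontfun f (g - h))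
      (apply_bcontfun (convolution f \<mu>) g *\<^sub>C T x)"
    by (simp add: bounded_clinear_def)
qed

text \<open>T maps the point mass at 0 with vector x to the one with vector \<open>T x\<close>, and
  integrating against it evaluates \<open>f (g - h)\<close> at h = 0.\<close>

lemma vconvolution_point:
  fixes f :: "'g::{topological_ab_group_add, t2_space} \<Rightarrow>\<^sub>C complex"
  assumes "bounded_clinear T"
  shows "apply_bcontfun (vconvolution T f (point_vmeasure 0 x)) g = apply_bcontfun f g *\<^sub>C T x"
proof (rule vconvolution_eqI)
  fix g
  have "T 0 = 0"
    using assms by (simp add: bounded_clinear_def linear_simps)
  then have eq: "(\<lambda>E. T (measure_of_set (point_vmeasure 0 x) E)) = point_measure 0 (T x)"
    by (auto simp: point_measure_def)
  show "has_integral_wrt (\<lambda>E. T (measure_of_set (point_vmeasure 0 x) E))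
      (\<lambda>h. apply_bcontfun f (g - h)) (apply_bcontfun f g *\<^sub>C T x)"
    unfolding eq using has_integral_wrt_point_measure[of 0 "T x" "\<lambda>h. apply_bcontfun f (g - h)"] by simp
qed


section \<open>Factorization\<close>

lemma bounded_operator_compose_type_space:
  assumes R: "bounded_operator V type_space R" and S: "bounded_operator type_space W S"
  shows "bounded_operator V W (\<lambda>x. S (R x))"
proof -
  obtain k where k: "\<And>x. x \<in> carrier V \<Longrightarrow> norm (R x) \<le> k * nrm V x"
    using R unfolding bounded_operator_def type_space_def by (simp, blast)
  obtain l where l: "\<And>y. nrm W (S y) \<le> l * norm y"
    using S unfolding bounded_operator_def type_space_def by (simp, blast)
  \<comment> \<open>The constant l of a bounded operator may be negative, so its absolute value is
    taken before the bound for \<open>R x\<close> is inserted.\<close>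
  have "nrm W (S (R x)) \<le> \<bar>l\<bar> * k * nrm V x" if "x \<in> carrier V" for x
  proof -
    have "nrm W (S (R x)) \<le> l * norm (R x)" by (rule l)
    also have "\<dots> \<le> \<bar>l\<bar> * norm (R x)" by (simp add: mult_right_mono)
    also have "\<dots> \<le> \<bar>l\<bar> * (k * nrm V x)" using k[OF that] by (simp add: mult_left_mono)
    finally show ?thesis by (simp add: mult.assoc)
  qed
  then have "\<exists>K. \<forall>x\<in>carrier V. nrm W (S (R x)) \<le> K * nrm V x" by blast
  then show ?thesis
    using R S by (auto simp: bounded_operator_def type_space_def)
qed

text \<open>D is absorbed into the inner map A and C into the outer map B, with H and U
  unchanged.\<close>

lemma factors_through_S_compose:
  assumes S: "factors_through_S TYPE('h) r s S"
    and C: "bounded_operator type_space type_space C"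
    and D: "bounded_operator type_space type_space D"
  shows "factors_through_S TYPE('h) r s (\<lambda>z. C (S (D z)))"
proof -
  obtain H :: "'h hspace" and U A B where *: "hilbert_space H" "U \<in> lorentz_schatten r s H"
      "bounded_operator type_space H A" "bounded_operator H type_space B" "S = (\<lambda>z. B (U (A z)))"
    using S unfolding factors_through_S_def by blast
  have "bounded_operator type_space H (\<lambda>z. A (D z))" "bounded_operator H type_space (\<lambda>h. C (B h))"
    using bounded_operator_compose_type_space * C D by blast+
  then show ?thesis
    unfolding factors_through_S_def using * by blast
qed

theorem theorem5p1:
  fixes f :: "'g::{topological_ab_group_add, t2_space} \<Rightarrow>\<^sub>C complex"
    and T :: "'x::complex_banach \<Rightarrow> 'y::complex_banach"
    and r s :: ereal
  assumes "compact (UNIV :: 'g set)"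
    and "f \<noteq> 0"
    and "bounded_clinear T"
    and "T \<noteq> (\<lambda>x. 0)"
    and "(0 < r \<and> r < \<infinity> \<and> 0 < s \<and> s < \<infinity>) \<or> (r = \<infinity> \<and> s = \<infinity>)"
    and "factors_through_S TYPE('h) r s (vconvolution T f :: ('g, 'x) vmeasure \<Rightarrow> 'g \<Rightarrow>\<^sub>C 'y)"
  shows "factors_through_S TYPE('h) r s (convolution f :: ('g, complex) vmeasure \<Rightarrow> 'g \<Rightarrow>\<^sub>C complex)
    \<and> factors_through_S TYPE('h) r s T"
proof
  obtain x where "T x \<noteq> 0" using assms(4) by blast
  then obtain \<phi> :: "'y \<Rightarrow> complex" where \<phi>: "bounded_clinear \<phi>" "\<phi> (T x) = 1"
    using complex_functional_exists by blast
  obtain C :: "('g \<Rightarrow>\<^sub>C 'y) \<Rightarrow> 'g \<Rightarrow>\<^sub>C complex" where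
    C: "bounded_operator type_space type_space C"
      "\<And>h g. apply_bcontfun (C h) g = \<phi> (apply_bcontfun h g)"
    using bounded_operator_comp_bcontfun[OF \<phi>(1)] by blast
  \<comment> \<open>At g, \<phi> sends the convolution value times \<open>T x\<close> to that value
    times \<open>\<phi> (T x)\<close>, which is 1.\<close>
  have "(convolution f :: ('g, complex) vmeasure \<Rightarrow> 'g \<Rightarrow>\<^sub>C complex) =
      (\<lambda>\<mu>. C (vconvolution T f (tensor_vmeasure \<mu> x)))"
    using \<phi> by (intro ext bcontfun_eqI)
      (simp add: C(2) vconvolution_tensor[OF assms(1,3)] bounded_clinear_def scaleC_complex_def)
  then show "factors_through_S TYPE('h) r s (convolution f :: ('g, complex) vmeasure \<Rightarrow> 'g \<Rightarrow>\<^sub>C complex)"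
    using factors_through_S_compose[OF assms(6) C(1) bounded_operator_tensor_vmeasure] by simp
next
  have "\<exists>g. apply_bcontfun f g \<noteq> 0"
    using assms(2) bcontfun_eqI[of f 0] by auto
  then obtain g where g: "apply_bcontfun f g \<noteq> 0" ..
  \<comment> \<open>The point mass at 0 produces \<open>f g *\<^sub>C T x\<close> at g; the scalar
    is cancelled by its inverse, which is part of the evaluation operator.\<close>
  have "T = (\<lambda>x. inverse (apply_bcontfun f g) *\<^sub>C
      apply_bcontfun (vconvolution T f (point_vmeasure 0 x)) g)"
    using g by (intro ext) (simp add: vconvolution_point[OF assms(3)] scaleC_scaleC scaleC_one)
  then show "factors_through_S TYPE('h) r s T"
    using factors_through_S_compose[OF assms(6) bounded_operator_scaled_evaluation
        bounded_operator_point_vmeasure] by metis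
qed

end
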